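(* There is a universal constant $c>0$ such that for all partial Boolean functions $f$ and $g$, \[\mathrm{R}(f\circ g)\ge c\cdot \widetilde{\mathrm{R}}(f)\cdot\mathrm{R}(g).\]
   Context: A partial Boolean function on $n$ bits is a map $f\colon \mathrm{Dom}(f)\to\{0,1\}$ with $\mathrm{Dom}(f)\subseteq\{0,1\}^n$. $\mathrm{R}(f)$ is the bounded-error (error $1/3$) randomized query complexity: the minimum over randomized decision trees (distributions over deterministic decision trees) that output $f(x)$ with probability at least $2/3$ for every $x\in\mathrm{Dom}(f)$, of the maximum number of queries of any tree in the support. For $f$ on $n$ bits and $g$ on $m$ bits, $f\circ g$ is the partial function on $nm$ bits with domain the strings $x^1\cdots x^n$ with $x^i\in\mathrm{Dom}(g)$ and $g(x^1)\cdots g(x^n)\in\mathrm{Dom}(f)$, and value $f(g(x^1)\cdots g(x^n))$. Noisy oracles: a noisy oracle for a bit $b\in\{0,1\}$ accepts a parameter $\gamma\in[0,1]$ and returns a fresh independent random bit equal to $b$ with probability $(1+\gamma)/2$; such a call costs $\gamma^2$. A noisy oracle decision tree on $n$ bits is a finite binary tree whose internal nodes are labeled by pairs $(i,\gamma)$ with $i\in[n]$, $\gamma\in[0,1]$ (repeated labels along a path allowed) and whose leaves are labeled by outputs; on input $x$ it starts at the root, at a node $(i,\gamma)$ calls the noisy oracle for $x_i$ with parameter $\gamma$ and moves to the left/right child according to whether the answer is $0$/$1$, and outputs the label of the leaf reached. The cost of a run is the sum of $\gamma^2$ over the nodes visited. A noisy oracle randomized algorithm $R$ is a finite-support distribution over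 such trees; $\mathrm{cost}(R,x)$ is its expected cost on $x$ (over the choice of tree and the oracle answers). $R$ computes $f$ to error $\epsilon$ if $\Pr[R(x)=f(x)]\ge1-\epsilon$ for all $x\in\mathrm{Dom}(f)$. $\widetilde{\mathrm{R}}_\epsilon(f)$ is the infimum over such $R$ of $\max_{x\in\mathrm{Dom}(f)}\mathrm{cost}(R,x)$, and $\widetilde{\mathrm{R}}(f)=\widetilde{\mathrm{R}}_{1/3}(f)$. *)

theory Defs
  imports "HOL-Probability.Probability"
begin

text \<open>
  An \<open>n\<close>-bit string is a \<^typ>\<open>bool list\<close> of length \<open>n\<close>, its bits being indexed by \<open>0, \<dots>, n - 1\<close>;
  \<open>False\<close> stands for 0 and \<open>True\<close> for 1.
\<close>

definition partial_boolean_function :: "nat \<Rightarrow> (bool list \<rightharpoonup> bool) \<Rightarrow> bool" where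
  "partial_boolean_function n f \<longleftrightarrow> dom f \<subseteq> {x. length x = n}"

definition block :: "nat \<Rightarrow> bool list \<Rightarrow> nat \<Rightarrow> bool list" where
  "block m x i = take m (drop (i * m) x)"

definition block_compose ::
  "nat \<Rightarrow> nat \<Rightarrow> (bool list \<rightharpoonup> bool) \<Rightarrow> (bool list \<rightharpoonup> bool) \<Rightarrow> (bool list \<rightharpoonup> bool)" where
  "block_compose n m f g = (\<lambda>x.
     if length x = n * m \<and> (\<forall>i<n. block m x i \<in> dom g)
     then f (map (\<lambda>i. the (g (block m x i))) [0..<n])
     else None)"

datatype dtree = Leaf bool | Query nat dtree dtree

primrec dtree_on :: "nat \<Rightarrow> dtree \<Rightarrow> bool" where
  "dtree_on n (Leaf b) \<longleftrightarrow> True"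
| "dtree_on n (Query i l r) \<longleftrightarrow> i < n \<and> dtree_on n l \<and> dtree_on n r"

primrec dtree_depth :: "dtree \<Rightarrow> nat" where
  "dtree_depth (Leaf b) = 0"
| "dtree_depth (Query i l r) = Suc (max (dtree_depth l) (dtree_depth r))"

primrec dtree_output :: "dtree \<Rightarrow> bool list \<Rightarrow> bool" where
  "dtree_output (Leaf b) x = b"
| "dtree_output (Query i l r) x = (if x ! i then dtree_output r x else dtree_output l x)"

definition randomized_computes :: "real \<Rightarrow> dtree pmf \<Rightarrow> (bool list \<rightharpoonup> bool) \<Rightarrow> bool" where
  "randomized_computes \<epsilon> P f \<longleftrightarrow>
     (\<forall>x \<in> dom f. pmf (map_pmf (\<lambda>T. dtree_output T x) P) (the (f x)) \<ge> 1 - \<epsilon>)"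

definition randomized_query_complexity :: "nat \<Rightarrow> (bool list \<rightharpoonup> bool) \<Rightarrow> nat" where
  "randomized_query_complexity n f =
     (LEAST d. \<exists>P. (\<forall>T \<in> set_pmf P. dtree_on n T \<and> dtree_depth T \<le> d) \<and>
                   randomized_computes (1/3) P f)"

definition noisy_oracle :: "real \<Rightarrow> bool \<Rightarrow> bool pmf" where
  "noisy_oracle \<gamma> b =
     map_pmf (\<lambda>correct. if correct then b else \<not> b) (bernoulli_pmf ((1 + \<gamma>) / 2))"

datatype noisy_tree = NLeaf bool | NQuery nat real noisy_tree noisy_tree

primrec noisy_tree_on :: "nat \<Rightarrow> noisy_tree \<Rightarrow> bool" where
  "noisy_tree_on n (NLeaf b) \<longleftrightarrow> True"
| "noisy_tree_on n (NQuery i \<gamma> l r) \<longleftrightarrow>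
     i < n \<and> \<gamma> \<in> {0..1} \<and> noisy_tree_on n l \<and> noisy_tree_on n r"

text \<open>Joint distribution of the output and the cost of a run of a tree on \<open>x\<close>.\<close>

primrec noisy_tree_run :: "noisy_tree \<Rightarrow> bool list \<Rightarrow> (bool \<times> real) pmf" where
  "noisy_tree_run (NLeaf b) x = return_pmf (b, 0)"
| "noisy_tree_run (NQuery i \<gamma> l r) x =
     bind_pmf (noisy_oracle \<gamma> (x ! i)) (\<lambda>a.
       map_pmf (\<lambda>(b, c). (b, \<gamma>\<^sup>2 + c)) (if a then noisy_tree_run r x else noisy_tree_run l x))"

definition noisy_algorithm :: "nat \<Rightarrow> noisy_tree pmf \<Rightarrow> bool" where
  "noisy_algorithm n R \<longleftrightarrow> finite (set_pmf R) \<and> (\<forall>T \<in> set_pmf R. noisy_tree_on n T)"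

definition noisy_run :: "noisy_tree pmf \<Rightarrow> bool list \<Rightarrow> (bool \<times> real) pmf" where
  "noisy_run R x = bind_pmf R (\<lambda>T. noisy_tree_run T x)"

definition noisy_cost :: "noisy_tree pmf \<Rightarrow> bool list \<Rightarrow> real" where
  "noisy_cost R x = measure_pmf.expectation (noisy_run R x) snd"

definition noisy_computes :: "real \<Rightarrow> noisy_tree pmf \<Rightarrow> (bool list \<rightharpoonup> bool) \<Rightarrow> bool" where
  "noisy_computes \<epsilon> R f \<longleftrightarrow>
     (\<forall>x \<in> dom f. pmf (map_pmf fst (noisy_run R x)) (the (f x)) \<ge> 1 - \<epsilon>)"

text \<open>
  Costs are nonnegative, so inserting 0 only matters for a function with empty domain, where it
  fixes the maximum over the empty set to be 0.
\<close>

definition noisy_max_cost :: "noisy_tree pmf \<Rightarrow> (bool list \<rightharpoonup> bool) \<Rightarrow> real" where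
  "noisy_max_cost R f = Max (insert 0 (noisy_cost R ` dom f))"

definition noisy_query_complexity_err :: "real \<Rightarrow> nat \<Rightarrow> (bool list \<rightharpoonup> bool) \<Rightarrow> real" where
  "noisy_query_complexity_err \<epsilon> n f =
     (INF R \<in> {R. noisy_algorithm n R \<and> noisy_computes \<epsilon> R f}. noisy_max_cost R f)"

definition noisy_query_complexity :: "nat \<Rightarrow> (bool list \<rightharpoonup> bool) \<Rightarrow> real" where
  "noisy_query_complexity n f = noisy_query_complexity_err (1/3) n f"

end

theory Submission imports Defs begin

text \<open>
  Consider the zero-sum game in which one player picks an input \<open>x\<close> of \<open>g\<close> and the other a decision tree
  with leaf labels \<open>a \<in> [-1, 1]\<close>, with payoff \<open>2 \<sigma> a - a\<^sup>2 - \<kappa> q\<close> for the latter, where \<open>\<sigma> = \<plusminus>1\<close> is the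
  value of \<open>g\<close> at \<open>x\<close> and \<open>q\<close> the number of queries. If some mixture of trees has positive payoff on all
  inputs, then summing up the labels of independent runs until the absolute value exceeds a constant
  is a random walk with a drift that dominates both its variance and \<open>\<kappa>\<close> times the queries, so \<open>g\<close> is
  computed with \<open>O(1/\<kappa>)\<close> queries. For \<open>\<kappa>\<close> a large constant over \<open>R(g)\<close> this is impossible, and minimax
  yields a distribution \<open>\<mu>\<close>, necessarily balanced, under which no tree has positive payoff: the squared
  bias about \<open>g\<close> gained by a tree is at most \<open>\<kappa>\<close> times its expected number of queries.

  An algorithm for \<open>f \<circ> g\<close> then becomes a noisy oracle algorithm for \<open>f\<close>: on input \<open>z\<close>, the \<open>i\<close>-th block is
  sampled bit by bit from \<open>\<mu>\<close> conditioned on the value \<open>z ! i\<close>, each bit at a noisy cost comparable to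
  the increase of the squared bias. Once the bias of a block exceeds \<open>1/3\<close>, a noiseless query reveals \<open>z ! i\<close>.
  The optimal payoff of the game continued from the current knowledge about a block is a potential
  function that bounds the total cost by \<open>O(\<kappa>)\<close> per query.
\<close>

section \<open>A theorem of the alternative and elementary inequalities\<close>

text \<open>Adding one index at a time reduces minimax to a separation in the plane: a certificate
  \<open>\<mu>\<close> for the vectors that are positive at the new index \<open>j\<close> is
  combined with the point mass at \<open>j\<close>, in a proportion read off from a separating
  line.\<close>

lemma positive_or_dual_certificate:
  fixes U :: "('i \<Rightarrow> real) set"
  assumes "finite I" "U \<noteq> {}"
    and "\<And>u v t. u \<in> U \<Longrightarrow> v \<in> U \<Longrightarrow> 0 \<le> t \<Longrightarrow> t \<le> 1 \<Longrightarrow> (\<lambda>i. (1 - t) * u i + t * v i) \<in> U"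
  shows "(\<exists>u\<in>U. \<forall>i\<in>I. u i > 0) \<or>
    (\<exists>\<mu>. (\<forall>i. \<mu> i \<ge> 0) \<and> (\<Sum>i\<in>I. \<mu> i) = 1 \<and> (\<forall>u\<in>U. (\<Sum>i\<in>I. \<mu> i * u i) \<le> 0))"
  using assms
proof (induction I arbitrary: U rule: finite_induct)
  case empty
  then show ?case by auto
next
  case (insert j I U)
  note conv = insert.prems(2)
  define U' where "U' = {u \<in> U. u j > 0}"
  show ?case
  proof (cases "U' = {}")
    case True
    let ?\<mu> = "\<lambda>i. if i = j then 1 else 0 :: real"
    have s: "(\<Sum>i\<in>insert j I. ?\<mu> i * u i) = u j" for u :: "'i \<Rightarrow> real"
    proof -
      have "(\<Sum>i\<in>insert j I. ?\<mu> i * u i) = (\<Sum>i\<in>insert j I. if i = j then u i else 0)"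
        by (rule sum.cong) auto
      then show ?thesis using insert.hyps by (simp add: sum.delta)
    qed
    have "(\<Sum>i\<in>insert j I. ?\<mu> i) = 1" using s[of "\<lambda>_. 1"] by simp
    moreover have "\<forall>u\<in>U. (\<Sum>i\<in>insert j I. ?\<mu> i * u i) \<le> 0"
      unfolding s using True by (force simp: U'_def)
    ultimately show ?thesis by (intro disjI2 exI[of _ ?\<mu>]) auto
  next
    case False
    have "(\<lambda>i. (1 - t) * u i + t * v i) \<in> U'"
      if "u \<in> U'" "v \<in> U'" "0 \<le> t" "t \<le> 1" for u v t
    proof -
      have "(1 - t) * u j + t * v j > 0"
      proof (cases "t = 1")
        case True then show ?thesis using that by (simp add: U'_def)
      next
        case False
        then have "(1 - t) * u j > 0" using that by (simp add: U'_def)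
        moreover have "t * v j \<ge> 0" using that by (simp add: U'_def)
        ultimately show ?thesis by linarith
      qed
      then show ?thesis using that conv by (auto simp: U'_def)
    qed
    from insert.IH[OF False this]
    show ?thesis
    proof
      assume "\<exists>u\<in>U'. \<forall>i\<in>I. 0 < u i"
      then show ?thesis by (force simp: U'_def)
    next
      assume "\<exists>\<mu>. (\<forall>i. \<mu> i \<ge> 0) \<and> (\<Sum>i\<in>I. \<mu> i) = 1 \<and> (\<forall>u\<in>U'. (\<Sum>i\<in>I. \<mu> i * u i) \<le> 0)"
      then obtain \<mu> where \<mu>: "\<And>i. \<mu> i \<ge> 0" "(\<Sum>i\<in>I. \<mu> i) = 1"
        "\<And>u. u \<in> U' \<Longrightarrow> (\<Sum>i\<in>I. \<mu> i * u i) \<le> 0" by blast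
      \<comment> \<open>\<open>S\<close> pairs the \<open>\<mu>\<close>-average with the entry at
        \<open>j\<close>. It misses the open quadrant \<open>Q\<close>: a vector positive at
        \<open>j\<close> lies in \<open>U'\<close>, where the average is at most 0.\<close>
      define S where "S = (\<lambda>u. ((\<Sum>i\<in>I. \<mu> i * u i), u j)) ` U"
      define Q where "Q = {x :: real \<times> real. fst x > 0 \<and> snd x > 0}"
      have "convex S"
        unfolding convex_alt S_def
      proof (intro ballI allI impI, elim imageE)
        fix x y t u v
        assume t: "0 \<le> t \<and> t \<le> (1::real)" and x: "x = ((\<Sum>i\<in>I. \<mu> i * u i), u j)" "u \<in> U"
          and y: "y = ((\<Sum>i\<in>I. \<mu> i * v i), v j)" "v \<in> U"
        show "(1 - t) *\<^sub>R x + t *\<^sub>R y \<in> (\<lambda>u. ((\<Sum>i\<in>I. \<mu> i * u i), u j)) ` U"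
          using conv[OF x(2) y(2)] t
          by (intro image_eqI[where x = "\<lambda>i. (1 - t) * u i + t * v i"])
            (auto simp: x y sum_distrib_left sum.distrib[symmetric] algebra_simps)
      qed
      moreover have "convex Q"
      proof -
        have "Q = {0<..} \<times> {0<..}" by (auto simp: Q_def)
        then show ?thesis by (simp add: convex_Times)
      qed
      moreover have "S \<noteq> {}" using insert.prems(1) by (simp add: S_def)
      moreover have "(1,1) \<in> Q" by (simp add: Q_def)
      moreover have "S \<inter> Q = {}" using \<mu>(3) by (force simp: S_def Q_def U'_def)
      ultimately obtain a b where ab: "a \<noteq> 0" "\<And>x. x \<in> S \<Longrightarrow> inner a x \<le> b"
        "\<And>x. x \<in> Q \<Longrightarrow> inner a x \<ge> b"
        using separating_hyperplane_sets[of S Q] by blast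
      obtain \<alpha> \<beta> where a: "a = (\<alpha>, \<beta>)" by (cases a)
      have Q: "b \<le> \<alpha> * x + \<beta> * y" if "x > 0" "y > 0" for x y
        using ab(3)[of "(x, y)"] that by (simp add: a Q_def)
      \<comment> \<open>\<open>Q\<close> is closed under positive scaling, so a negative value of
        the functional on it could be scaled below \<open>b\<close>.\<close>
      have cone: "0 \<le> \<alpha> * x + \<beta> * y" if "x > 0" "y > 0" for x y
      proof (rule ccontr)
        assume neg': "\<not> ?thesis"
        define c where "c = \<alpha> * x + \<beta> * y"
        define k where "k = (\<bar>b\<bar> + 1) / - c"
        have neg: "c < 0" using neg' by (simp add: c_def)
        have "k > 0" using neg by (simp add: k_def divide_pos_neg)
        then have "b \<le> \<alpha> * (k * x) + \<beta> * (k * y)" using Q that by simp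
        also have "\<dots> = k * c" by (simp add: c_def algebra_simps)
        also have "\<dots> = - (\<bar>b\<bar> + 1)" using neg by (simp add: k_def field_simps)
        finally show False by linarith
      qed
      have nonneg: "0 \<le> c" if "\<And>e. e > 0 \<Longrightarrow> 0 \<le> c + d * e" for c d :: real
      proof (rule tendsto_lowerbound)
        show "((\<lambda>e. c + d * e) \<longlongrightarrow> c) (at_right 0)"
          by (auto intro!: tendsto_eq_intros)
        show "\<forall>\<^sub>F e in at_right 0. 0 \<le> c + d * e"
          using that by (auto simp: eventually_at_filter)
      qed simp
      have "\<alpha> \<ge> 0" by (rule nonneg[of _ \<beta>]) (use cone[of 1] in simp)
      have "\<beta> \<ge> 0" by (rule nonneg[of _ \<alpha>]) (use cone[of _ 1] in \<open>simp add: add.commute\<close>)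
      have "- b \<ge> 0"
      proof (rule nonneg[of _ "\<alpha> + \<beta>"])
        fix e :: real assume "e > 0"
        then show "0 \<le> - b + (\<alpha> + \<beta>) * e" using Q[of e e] by (simp add: algebra_simps)
      qed
      have pos: "\<alpha> + \<beta> > 0" using \<open>\<alpha> \<ge> 0\<close> \<open>\<beta> \<ge> 0\<close> ab(1) by (auto simp: a prod_eq_iff)
      \<comment> \<open>The nonnegative normal of the separating line mixes \<open>\<mu>\<close>
        with the point mass at \<open>j\<close>.\<close>
      define \<nu> where "\<nu> i = (if i = j then \<beta> else \<alpha> * \<mu> i) / (\<alpha> + \<beta>)" for i
      have \<nu>: "(\<Sum>i\<in>insert j I. \<nu> i * u i) = (\<alpha> * (\<Sum>i\<in>I. \<mu> i * u i) + \<beta> * u j) / (\<alpha> + \<beta>)" for u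
      proof -
        have "(\<Sum>i\<in>I. \<nu> i * u i) = (\<Sum>i\<in>I. \<alpha> * (\<mu> i * u i) / (\<alpha> + \<beta>))"
          using insert.hyps by (intro sum.cong) (auto simp: \<nu>_def)
        then show ?thesis using insert.hyps
          by (simp add: \<nu>_def sum_distrib_left sum_divide_distrib[symmetric] add_divide_distrib)
      qed
      have "(\<Sum>i\<in>insert j I. \<nu> i) = 1" using \<nu>[of "\<lambda>_. 1"] \<mu>(2) pos by simp
      moreover have "(\<Sum>i\<in>insert j I. \<nu> i * u i) \<le> 0" if "u \<in> U" for u
      proof -
        have "\<alpha> * (\<Sum>i\<in>I. \<mu> i * u i) + \<beta> * u j \<le> b"
          using ab(2)[of "((\<Sum>i\<in>I. \<mu> i * u i), u j)"] that by (auto simp: S_def a)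
        then show ?thesis using \<open>- b \<ge> 0\<close> pos unfolding \<nu> by (simp add: divide_nonpos_pos)
      qed
      moreover have "\<nu> i \<ge> 0" for i
        using \<mu>(1) \<open>\<alpha> \<ge> 0\<close> \<open>\<beta> \<ge> 0\<close> by (simp add: \<nu>_def)
      ultimately show ?thesis by blast
    qed
  qed
qed

text \<open>For weights \<open>u\<close> and \<open>v\<close> of the values 1 and 0, this is the
  total weight times the square of the conditional expectation of the signed value; it is 0 if both
  weights vanish.\<close>

definition bias_value :: "real \<Rightarrow> real \<Rightarrow> real" where
  "bias_value u v = (u - v)\<^sup>2 / (u + v)"

lemma bias_value_alt:
  assumes "u \<ge> 0" "v \<ge> 0"
  shows "bias_value u v = u + v - 4 * (u * v / (u + v))"
proof (cases "u + v = 0")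
  case True
  then show ?thesis using assms by (simp add: bias_value_def)
next
  case False
  then show ?thesis
    by (simp add: bias_value_def divide_simps) (simp add: power2_eq_square algebra_simps)
qed

text \<open>The increase equals \<open>4 (u v)\<^sup>2 (p - q)\<^sup>2 / ((u + v) A B)\<close>,
  where \<open>A\<close> and \<open>B\<close> are the weights of the two answers. Odds of at most
  two to one give \<open>u v \<ge> 2/9 (u + v)\<^sup>2\<close> and
  \<open>A B \<le> 8/9 r (u + v)\<^sup>2\<close>, so the left-hand side, a cost of simulating the
  answer, is at most 9/2 times the increase; 5 rounds this up.\<close>

lemma bias_value_gain:
  fixes u v p q :: real
  assumes "u > 0" "v > 0" "u \<le> 2 * v" "v \<le> 2 * u" "0 \<le> p" "p \<le> 1" "0 \<le> q" "q \<le> 1"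
  shows "(p - q)\<^sup>2 / min (p + q) (2 - p - q) * (u + v) \<le>
    5 * (bias_value (p * u) (q * v) + bias_value ((1 - p) * u) ((1 - q) * v) - bias_value u v)"
proof -
  define r where "r = min (p + q) (2 - p - q)"
  define A where "A = p * u + q * v"
  define B where "B = (1 - p) * u + (1 - q) * v"
  have AB: "A + B = u + v" by (simp add: A_def B_def algebra_simps)
  show ?thesis
  proof (cases "r = 0")
    case True
    \<comment> \<open>Here \<open>p = q\<close>, so the left side is 0 by the convention on
      division, while one of the two answers carries all the weight and the bias does not
      change.\<close>
    then have "p = 0 \<and> q = 0 \<or> p = 1 \<and> q = 1"
      using assms by (auto simp: r_def min_def split: if_splits)
    then show ?thesis by (auto simp: bias_value_def)
  next
    case False
    have r: "r > 0" using False assms by (auto simp: r_def min_def split: if_splits)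
    have "p > 0 \<or> q > 0" "p < 1 \<or> q < 1" using r assms by (auto simp: r_def)
    then have A: "A > 0" and B: "B > 0" using assms
      by (auto simp: A_def B_def intro: add_pos_nonneg add_nonneg_pos)
    define X where "X = 4 * ((u * v)\<^sup>2 * (p - q)\<^sup>2 / ((u + v) * A * B))"
    have gap: "bias_value (p * u) (q * v) + bias_value ((1 - p) * u) ((1 - q) * v) - bias_value u v = X"
    proof -
      have "u * v / (u + v) - (p * u) * (q * v) / A - ((1 - p) * u) * ((1 - q) * v) / B
        = (u * v)\<^sup>2 * (p - q)\<^sup>2 / ((u + v) * A * B)"
      proof -
        have "(u * v * (A * B) - (p * u) * (q * v) * (u + v) * B - ((1 - p) * u) * ((1 - q) * v) * ((u + v) * A))
          = (u * v)\<^sup>2 * (p - q)\<^sup>2"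
          unfolding A_def B_def by algebra
        moreover have "u + v \<noteq> 0" using assms by simp
        ultimately show ?thesis using A B by (simp add: divide_simps) (simp add: algebra_simps)
      qed
      then show ?thesis
        using assms AB by (simp add: bias_value_alt X_def A_def[symmetric] B_def[symmetric])
    qed
    define w where "w = u + v"
    have w: "w > 0" using assms by (simp add: w_def)
    have uv: "u * v \<ge> 2 / 9 * w\<^sup>2"
    proof -
      have "0 \<le> (2 * v - u) * (2 * u - v)" using assms by simp
      then show ?thesis by (simp add: w_def power2_eq_square algebra_simps)
    qed
    have uv2: "(u * v)\<^sup>2 \<ge> (2 / 9 * w\<^sup>2)\<^sup>2"
      using uv by (intro power_mono) auto
    have "A \<le> 2 / 3 * w * (p + q)"
      using mult_left_mono[of u "2/3*w" p] mult_left_mono[of v "2/3*w" q] assms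
      by (simp add: A_def w_def algebra_simps)
    moreover have "B \<le> 2 / 3 * w * (2 - p - q)"
      using mult_left_mono[of u "2/3*w" "1-p"] mult_left_mono[of v "2/3*w" "1-q"] assms
      by (simp add: B_def w_def algebra_simps)
    ultimately have "A * B \<le> (2 / 3 * w * (p + q)) * (2 / 3 * w * (2 - p - q))"
      using A B by (intro mult_mono) auto
    also have "\<dots> = 4 / 9 * w\<^sup>2 * ((p + q) * (2 - p - q))" by (simp add: power2_eq_square)
    also have "\<dots> \<le> 4 / 9 * w\<^sup>2 * (2 * r)"
    proof (rule mult_left_mono)
      have "(p + q) * (2 - p - q) \<le> 2 * (2 - p - q)" "(p + q) * (2 - p - q) \<le> (p + q) * 2"
        using assms by (intro mult_right_mono mult_left_mono; simp)+
      then show "(p + q) * (2 - p - q) \<le> 2 * r" by (simp add: r_def min_def)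
    qed simp
    finally have AB2: "A * B \<le> 8 / 9 * w\<^sup>2 * r" by simp
    have "(2 / 9 * w\<^sup>2)\<^sup>2 * (p - q)\<^sup>2 / (w * (8 / 9 * w\<^sup>2 * r)) \<le> (u * v)\<^sup>2 * (p - q)\<^sup>2 / (w * (A * B))"
      using uv2 AB2 A B w by (intro frac_le mult_right_mono mult_left_mono[where c = w]) auto
    moreover have "X = 4 * ((u * v)\<^sup>2 * (p - q)\<^sup>2 / (w * (A * B)))"
      by (simp add: X_def w_def mult.assoc)
    ultimately have "4 * ((2 / 9 * w\<^sup>2)\<^sup>2 * (p - q)\<^sup>2 / (w * (8 / 9 * w\<^sup>2 * r))) \<le> X"
      by linarith
    also have "4 * ((2 / 9 * w\<^sup>2)\<^sup>2 * (p - q)\<^sup>2 / (w * (8 / 9 * w\<^sup>2 * r))) = 2 / 9 * w * (p - q)\<^sup>2 / r"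
      using w r by (simp add: field_simps power2_eq_square)
    finally have "(p - q)\<^sup>2 / r * w \<le> 9 / 2 * X" using r by (simp add: field_simps)
    moreover have "X \<ge> 0" using A B assms by (simp add: X_def)
    ultimately show ?thesis unfolding gap r_def w_def by linarith
  qed
qed

lemma exp_minus_le_quadratic:
  fixes y :: real
  assumes "\<bar>y\<bar> \<le> 1"
  shows "exp (- y) \<le> 1 - y + y\<^sup>2"
proof (cases "y \<ge> 0")
  case True
  have "exp (- y) = 1 / exp y" by (simp add: exp_minus field_simps)
  also have "\<dots> \<le> 1 / (1 + y)" using True by (intro frac_le) auto
  also have "\<dots> \<le> 1 - y + y\<^sup>2"
    using True by (simp add: field_simps power2_eq_square)
  finally show ?thesis .
next
  case False
  then show ?thesis using exp_bound[of "- y"] assms by simp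
qed

section \<open>Labelled decision trees and amplification\<close>

lemma expectation_bind_finite:
  fixes h :: "'b \<Rightarrow> real"
  assumes "finite (set_pmf R)" "\<And>D. D \<in> set_pmf R \<Longrightarrow> finite (set_pmf (F D))"
  shows "measure_pmf.expectation (bind_pmf R F) h =
    measure_pmf.expectation R (\<lambda>D. measure_pmf.expectation (F D) h)"
proof -
  have "measure_pmf.expectation (bind_pmf R F) h =
      (\<Sum>D\<in>set_pmf R. pmf R D *\<^sub>R measure_pmf.expectation (F D) h)"
    using assms by (intro pmf_expectation_bind) auto
  also have "\<dots> = measure_pmf.expectation R (\<lambda>D. measure_pmf.expectation (F D) h)"
    using assms by (intro integral_measure_pmf[symmetric]) auto
  finally show ?thesis .
qed

lemma expectation_mono_finite:
  fixes u v :: "'a \<Rightarrow> real"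
  assumes "finite (set_pmf R)" "\<And>D. D \<in> set_pmf R \<Longrightarrow> u D \<le> v D"
  shows "measure_pmf.expectation R u \<le> measure_pmf.expectation R v"
  using assms by (intro integral_mono_AE integrable_measure_pmf_finite) (auto simp: AE_measure_pmf_iff)

definition mix_pmf :: "real \<Rightarrow> 'a pmf \<Rightarrow> 'a pmf \<Rightarrow> 'a pmf" where
  "mix_pmf t A B = bind_pmf (bernoulli_pmf t) (\<lambda>c. if c then B else A)"

lemma expectation_mix_pmf:
  fixes h :: "'a \<Rightarrow> real"
  assumes "finite (set_pmf A)" "finite (set_pmf B)" "0 \<le> t" "t \<le> 1"
  shows "measure_pmf.expectation (mix_pmf t A B) h =
    (1 - t) * measure_pmf.expectation A h + t * measure_pmf.expectation B h"
  unfolding mix_pmf_def using assms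
  by (subst expectation_bind_finite) (auto intro: finite_subset[OF subset_UNIV])

lemma set_mix_pmf_subset: "set_pmf (mix_pmf t A B) \<subseteq> set_pmf A \<union> set_pmf B"
  by (auto simp: mix_pmf_def split: if_splits)

datatype ltree = LLeaf real | LQuery nat ltree ltree

primrec ltree_on :: "nat \<Rightarrow> ltree \<Rightarrow> bool" where
  "ltree_on m (LLeaf a) \<longleftrightarrow> \<bar>a\<bar> \<le> 1"
| "ltree_on m (LQuery i l r) \<longleftrightarrow> i < m \<and> ltree_on m l \<and> ltree_on m r"

primrec ltree_label :: "ltree \<Rightarrow> bool list \<Rightarrow> real" where
  "ltree_label (LLeaf a) x = a"
| "ltree_label (LQuery i l r) x = (if x ! i then ltree_label r x else ltree_label l x)"

primrec ltree_cost :: "ltree \<Rightarrow> bool list \<Rightarrow> nat" where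
  "ltree_cost (LLeaf a) x = 0"
| "ltree_cost (LQuery i l r) x = Suc (if x ! i then ltree_cost r x else ltree_cost l x)"

lemma ltree_label_bound: "ltree_on m D \<Longrightarrow> \<bar>ltree_label D x\<bar> \<le> 1"
  by (induction D) auto

primrec dtree_cost :: "dtree \<Rightarrow> bool list \<Rightarrow> nat" where
  "dtree_cost (Leaf b) x = 0"
| "dtree_cost (Query i l r) x = Suc (if x ! i then dtree_cost r x else dtree_cost l x)"

text \<open>Turns a bound on the expected number of queries into one on the depth. The leaf
  \<open>False\<close> at a cut is arbitrary: every cut run is later counted as an error.\<close>

primrec dtree_truncate :: "nat \<Rightarrow> dtree \<Rightarrow> dtree" where
  "dtree_truncate d (Leaf b) = Leaf b"
| "dtree_truncate d (Query i l r) =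
     (if d = 0 then Leaf False else Query i (dtree_truncate (d - 1) l) (dtree_truncate (d - 1) r))"

lemma dtree_truncate_depth: "dtree_depth (dtree_truncate d T) \<le> d"
proof (induction T arbitrary: d)
  case (Query i l r)
  show ?case using Query.IH[of "d - 1"] by auto
qed simp

lemma dtree_truncate_on: "dtree_on m T \<Longrightarrow> dtree_on m (dtree_truncate d T)"
  by (induction T arbitrary: d) auto

lemma dtree_truncate_output:
  "dtree_cost T x \<le> d \<Longrightarrow> dtree_output (dtree_truncate d T) x = dtree_output T x"
  by (induction T arbitrary: d) (auto split: if_splits)

definition value_sign :: "(bool list \<rightharpoonup> bool) \<Rightarrow> bool list \<Rightarrow> real" where
  "value_sign g x = (if g x = Some True then 1 else - 1)"

text \<open>
  For a distribution of inputs, the best label of a leaf is the conditional expectation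
  \<open>a\<close> of \<^const>\<open>value_sign\<close>, which makes the first two terms contribute \<open>a\<^sup>2\<close>: the payoff weighs the
  squared bias gained by a tree against the number of its queries.
\<close>

definition payoff :: "real \<Rightarrow> (bool list \<rightharpoonup> bool) \<Rightarrow> ltree \<Rightarrow> bool list \<Rightarrow> real" where
  "payoff \<kappa> g D x = 2 * (value_sign g x * ltree_label D x) - (ltree_label D x)\<^sup>2 - \<kappa> * ltree_cost D x"

text \<open>Each leaf of \<open>D\<close> continues with its own independent draw from
  \<open>k\<close> at its label. An input reaches one leaf only, so the draws elsewhere integrate
  out. The function \<open>h\<close> may depend on the input, so that it can be the indicator of a
  wrong output.\<close>

lemma graft_exists:
  assumes "ltree_on m D"
    and k: "\<And>a. finite (set_pmf (k a))" "\<And>a T. T \<in> set_pmf (k a) \<Longrightarrow> dtree_on m T"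
  shows "\<exists>P. finite (set_pmf P) \<and> (\<forall>T\<in>set_pmf P. dtree_on m T) \<and>
    (\<forall>x. measure_pmf.expectation P (\<lambda>T. (h (dtree_output T x) x :: real)) =
         measure_pmf.expectation (k (ltree_label D x)) (\<lambda>T. h (dtree_output T x) x)) \<and>
    (\<forall>x. measure_pmf.expectation P (\<lambda>T. real (dtree_cost T x)) =
         ltree_cost D x + measure_pmf.expectation (k (ltree_label D x)) (\<lambda>T. real (dtree_cost T x)))"
  using assms(1)
proof (induction D)
  case (LLeaf a)
  show ?case by (rule exI[of _ "k a"]) (auto simp: k)
next
  case (LQuery i l r)
  then have "i < m" by simp
  from LQuery obtain Pl where
    Pl: "finite (set_pmf Pl)" "\<And>T. T \<in> set_pmf Pl \<Longrightarrow> dtree_on m T"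
    "\<And>x. measure_pmf.expectation Pl (\<lambda>T. h (dtree_output T x) x) =
         measure_pmf.expectation (k (ltree_label l x)) (\<lambda>T. h (dtree_output T x) x)"
    "\<And>x. measure_pmf.expectation Pl (\<lambda>T. real (dtree_cost T x)) =
         ltree_cost l x + measure_pmf.expectation (k (ltree_label l x)) (\<lambda>T. real (dtree_cost T x))"
    by auto
  from LQuery obtain Pr where
    Pr: "finite (set_pmf Pr)" "\<And>T. T \<in> set_pmf Pr \<Longrightarrow> dtree_on m T"
    "\<And>x. measure_pmf.expectation Pr (\<lambda>T. h (dtree_output T x) x) =
         measure_pmf.expectation (k (ltree_label r x)) (\<lambda>T. h (dtree_output T x) x)"
    "\<And>x. measure_pmf.expectation Pr (\<lambda>T. real (dtree_cost T x)) =
         ltree_cost r x + measure_pmf.expectation (k (ltree_label r x)) (\<lambda>T. real (dtree_cost T x))"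
    by auto
  define P where "P = bind_pmf Pl (\<lambda>tl. map_pmf (Query i tl) Pr)"
  have E: "measure_pmf.expectation P w =
      measure_pmf.expectation Pl (\<lambda>tl. measure_pmf.expectation Pr (\<lambda>tr. w (Query i tl tr)))" for w :: "dtree \<Rightarrow> real"
    unfolding P_def using Pl(1) Pr(1) by (subst expectation_bind_finite) auto
  have int: "integrable (measure_pmf Pl) w" "integrable (measure_pmf Pr) w" for w :: "dtree \<Rightarrow> real"
    using Pl(1) Pr(1) by (auto intro: integrable_measure_pmf_finite)
  show ?case
  proof (intro exI[of _ P] conjI allI ballI)
    show "finite (set_pmf P)" using Pl(1) Pr(1) by (auto simp: P_def)
    show "dtree_on m T" if "T \<in> set_pmf P" for T
      using that Pl(2) Pr(2) \<open>i < m\<close> by (auto simp: P_def)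
    show "measure_pmf.expectation P (\<lambda>T. h (dtree_output T x) x) =
         measure_pmf.expectation (k (ltree_label (LQuery i l r) x)) (\<lambda>T. h (dtree_output T x) x)" for x
      unfolding E by (simp add: Pl(3) Pr(3))
    show "measure_pmf.expectation P (\<lambda>T. real (dtree_cost T x)) =
         ltree_cost (LQuery i l r) x + measure_pmf.expectation (k (ltree_label (LQuery i l r) x)) (\<lambda>T. real (dtree_cost T x))" for x
      unfolding E by (simp add: Pl(4) Pr(4) int)
  qed
qed

text \<open>The random walk with current sum \<open>s\<close> and \<open>N\<close> rounds left,
  stopped once \<open>\<bar>s\<bar> \<ge> K\<close>. The two error terms account for stopping on the
  wrong side and for running out of rounds. The cost bound is a potential that is linear in the
  signed sum; \<open>K + 1\<close> appears because the last step may overshoot \<open>K\<close> by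
  1.\<close>

lemma amplification_exists:
  fixes R :: "ltree pmf" and V \<kappa> K s :: real
  assumes R: "finite (set_pmf R)" "\<And>D. D \<in> set_pmf R \<Longrightarrow> ltree_on m D"
    and V: "V > 0" "V \<le> 2" "\<And>x. x \<in> dom g \<Longrightarrow> measure_pmf.expectation R (\<lambda>D. payoff \<kappa> g D x) \<ge> V"
    and pos: "\<kappa> > 0" "K > 0"
  shows "\<exists>P. finite (set_pmf P) \<and> (\<forall>T\<in>set_pmf P. dtree_on m T) \<and>
    (\<forall>x\<in>dom g.
      measure_pmf.expectation P (\<lambda>T. of_bool (dtree_output T x \<noteq> the (g x))) \<le>
        exp (- (K + value_sign g x * s) / 4) + (1 - V / 16) ^ N * exp ((K - value_sign g x * s) / 4) \<and>
      (value_sign g x * s \<le> K + 1 \<longrightarrow>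
        measure_pmf.expectation P (\<lambda>T. real (dtree_cost T x)) \<le> 2 / \<kappa> * (K + 1 - value_sign g x * s)))"
proof (induction N arbitrary: s)
  case 0
  show ?case
  proof (intro exI[of _ "return_pmf (Leaf (s > 0))"] conjI ballI impI)
    fix x assume "x \<in> dom g"
    let ?z = "value_sign g x * s"
    \<comment> \<open>With no rounds left the sign of \<open>s\<close> is output: it is right if
      \<open>?z > K\<close>, and otherwise the bound is at least 1.\<close>
    have "of_bool ((s > 0) \<noteq> the (g x)) \<le> exp ((K - ?z) / 4)"
    proof (cases "?z \<le> K")
      case True
      then show ?thesis by (simp add: order_trans[of _ 1])
    next
      case False
      then show ?thesis using \<open>x \<in> dom g\<close> pos by (auto simp: value_sign_def split: if_splits)
    qed
    then show "measure_pmf.expectation (return_pmf (Leaf (s > 0))) (\<lambda>T. of_bool (dtree_output T x \<noteq> the (g x))) \<le>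
        exp (- (K + ?z) / 4) + (1 - V / 16) ^ 0 * exp ((K - ?z) / 4)"
      by (simp add: add_increasing)
  qed (use pos in auto)
next
  case (Suc N)
  show ?case
  proof (cases "\<bar>s\<bar> \<ge> K")
    case True
    show ?thesis
    proof (intro exI[of _ "return_pmf (Leaf (s > 0))"] conjI ballI impI)
      fix x assume "x \<in> dom g"
      let ?z = "value_sign g x * s"
      \<comment> \<open>At the threshold a wrong sign means \<open>?z \<le> - K\<close>, where the
        first error term is at least 1.\<close>
      have "of_bool ((s > 0) \<noteq> the (g x)) \<le> exp (- (K + ?z) / 4)"
        using True \<open>x \<in> dom g\<close> pos by (auto simp: value_sign_def split: if_splits)
      moreover have "0 \<le> (1 - V / 16) ^ Suc N * exp ((K - ?z) / 4)"
        using V by simp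
      ultimately show "measure_pmf.expectation (return_pmf (Leaf (s > 0))) (\<lambda>T. of_bool (dtree_output T x \<noteq> the (g x))) \<le>
        exp (- (K + ?z) / 4) + (1 - V / 16) ^ Suc N * exp ((K - ?z) / 4)"
        by simp
    qed (use pos in auto)
  next
    case False
    let ?err = "\<lambda>x T. of_bool (dtree_output T x \<noteq> the (g x)) :: real"
    let ?cost = "\<lambda>x T. real (dtree_cost T x)"
    let ?bd = "\<lambda>z. exp (- (K + z) / 4) + (1 - V / 16) ^ N * exp ((K - z) / 4)"
    obtain k where k: "\<And>s. finite (set_pmf (k s))" "\<And>s T. T \<in> set_pmf (k s) \<Longrightarrow> dtree_on m T"
      "\<And>s x. x \<in> dom g \<Longrightarrow> measure_pmf.expectation (k s) (?err x) \<le> ?bd (value_sign g x * s)"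
      "\<And>s x. x \<in> dom g \<Longrightarrow> value_sign g x * s \<le> K + 1 \<Longrightarrow>
         measure_pmf.expectation (k s) (?cost x) \<le> 2 / \<kappa> * (K + 1 - value_sign g x * s)"
      using Suc.IH by metis
    have "\<exists>F. \<forall>D. ltree_on m D \<longrightarrow> finite (set_pmf (F D)) \<and> (\<forall>T\<in>set_pmf (F D). dtree_on m T) \<and>
      (\<forall>x. measure_pmf.expectation (F D) (?err x) =
         measure_pmf.expectation (k (s + ltree_label D x)) (?err x)) \<and>
      (\<forall>x. measure_pmf.expectation (F D) (?cost x) =
         ltree_cost D x + measure_pmf.expectation (k (s + ltree_label D x)) (?cost x))"
      using graft_exists[of m _ "\<lambda>a. k (s + a)" "\<lambda>b x. of_bool (b \<noteq> the (g x))"] k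
      by (intro choice allI) blast
    then obtain F where F: "\<And>D. ltree_on m D \<Longrightarrow> finite (set_pmf (F D))"
      "\<And>D T. ltree_on m D \<Longrightarrow> T \<in> set_pmf (F D) \<Longrightarrow> dtree_on m T"
      "\<And>D x. ltree_on m D \<Longrightarrow> measure_pmf.expectation (F D) (?err x) =
         measure_pmf.expectation (k (s + ltree_label D x)) (?err x)"
      "\<And>D x. ltree_on m D \<Longrightarrow> measure_pmf.expectation (F D) (?cost x) =
         ltree_cost D x + measure_pmf.expectation (k (s + ltree_label D x)) (?cost x)"
      by blast
    define P where "P = bind_pmf R F"
    have E: "measure_pmf.expectation P w = measure_pmf.expectation R (\<lambda>D. measure_pmf.expectation (F D) w)" for w :: "dtree \<Rightarrow> real"
      unfolding P_def using R F by (intro expectation_bind_finite) auto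
    have int: "integrable (measure_pmf R) w" for w :: "ltree \<Rightarrow> real"
      using R(1) by (rule integrable_measure_pmf_finite)
    show ?thesis
    proof (intro exI[of _ P] conjI ballI impI)
      show "finite (set_pmf P)" using R F by (auto simp: P_def)
      show "dtree_on m T" if "T \<in> set_pmf P" for T
        using that R F(2) by (auto simp: P_def)
    next
      fix x assume x: "x \<in> dom g"
      define \<sigma> where "\<sigma> = value_sign g x"
      have \<sigma>: "\<bar>\<sigma>\<bar> = 1" "\<sigma>\<^sup>2 = 1" by (auto simp: \<sigma>_def value_sign_def)
      let ?X = "\<lambda>D. \<sigma> * ltree_label D x"
      define \<delta> where "\<delta> = measure_pmf.expectation R ?X"
      define q where "q = measure_pmf.expectation R (\<lambda>D. real (ltree_cost D x))"
      define v where "v = measure_pmf.expectation R (\<lambda>D. (ltree_label D x)\<^sup>2)"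
      have pay: "2 * \<delta> - v - \<kappa> * q \<ge> V"
        using V(3)[OF x] by (simp add: payoff_def int \<delta>_def v_def q_def \<sigma>_def)
      have q0: "q \<ge> 0" unfolding q_def by (rule integral_nonneg_AE) simp
      have v0: "v \<ge> 0" unfolding v_def by (rule integral_nonneg_AE) simp
      have X: "\<bar>?X D\<bar> \<le> 1" if "D \<in> set_pmf R" for D
        using ltree_label_bound[OF R(2)[OF that]] \<sigma> by (simp add: abs_mult)
      \<comment> \<open>The exponential moment of a step contracts: positive payoff makes the drift
        \<open>\<delta>\<close> at least \<open>(V + v) / 2\<close>, which beats the second-order
        term \<open>v / 16\<close>.\<close>
      have "measure_pmf.expectation R (\<lambda>D. exp (- ?X D / 4)) \<le>
          measure_pmf.expectation R (\<lambda>D. 1 - ?X D / 4 + (ltree_label D x)\<^sup>2 / 16)"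
      proof (rule expectation_mono_finite[OF R(1)])
        fix D assume "D \<in> set_pmf R"
        then have "exp (- (?X D / 4)) \<le> 1 - ?X D / 4 + (?X D / 4)\<^sup>2"
          using X[of D] by (intro exp_minus_le_quadratic) auto
        then show "exp (- ?X D / 4) \<le> 1 - ?X D / 4 + (ltree_label D x)\<^sup>2 / 16"
          using \<sigma> by (simp add: power_mult_distrib power_divide)
      qed
      also have "\<dots> = 1 - \<delta> / 4 + v / 16" by (simp add: int \<delta>_def v_def)
      also have "\<dots> \<le> 1 - V / 16" 
      proof -
        have "0 \<le> \<kappa> * q" using q0 pos by simp
        then show ?thesis using pay v0 V(1) by linarith
      qed
      finally have decay: "measure_pmf.expectation R (\<lambda>D. exp (- ?X D / 4)) \<le> 1 - V / 16" .
      have V1: "0 \<le> 1 - V / 16" "1 - V / 16 \<le> 1" using V by auto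
      have "measure_pmf.expectation P (?err x) \<le> measure_pmf.expectation R (\<lambda>D. ?bd (\<sigma> * s) * exp (- ?X D / 4))"
        unfolding E
      proof (rule expectation_mono_finite[OF R(1)])
        fix D assume D: "D \<in> set_pmf R"
        have "measure_pmf.expectation (F D) (?err x) \<le> ?bd (\<sigma> * (s + ltree_label D x))"
          using k(3)[OF x] F(3) R(2)[OF D] by (simp add: \<sigma>_def)
        also have "\<dots> = ?bd (\<sigma> * s) * exp (- ?X D / 4)"
          by (simp add: algebra_simps exp_add[symmetric] diff_divide_distrib add_divide_distrib)
        finally show "measure_pmf.expectation (F D) (?err x) \<le> ?bd (\<sigma> * s) * exp (- ?X D / 4)" .
      qed
      also have "\<dots> = ?bd (\<sigma> * s) * measure_pmf.expectation R (\<lambda>D. exp (- ?X D / 4))" by simp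
      also have "\<dots> \<le> ?bd (\<sigma> * s) * (1 - V / 16)"
        using decay V1 by (intro mult_left_mono) auto
      also have "\<dots> = exp (- (K + \<sigma> * s) / 4) * (1 - V / 16) + (1 - V / 16) ^ Suc N * exp ((K - \<sigma> * s) / 4)"
        by (simp add: algebra_simps)
      also have "\<dots> \<le> exp (- (K + \<sigma> * s) / 4) + (1 - V / 16) ^ Suc N * exp ((K - \<sigma> * s) / 4)"
        using V1 by (intro add_right_mono mult_left_le) auto
      finally show "measure_pmf.expectation P (?err x) \<le>
        exp (- (K + value_sign g x * s) / 4) + (1 - V / 16) ^ Suc N * exp ((K - value_sign g x * s) / 4)"
        by (simp add: \<sigma>_def)
      have "measure_pmf.expectation P (?cost x) \<le>
          measure_pmf.expectation R (\<lambda>D. ltree_cost D x + 2 / \<kappa> * (K + 1 - \<sigma> * s - ?X D))"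
        unfolding E
      proof (rule expectation_mono_finite[OF R(1)])
        fix D assume D: "D \<in> set_pmf R"
        have "\<sigma> * s \<le> K" using False \<sigma> by (metis abs_le_D1 abs_mult linorder_not_le mult_1 order_less_imp_le)
        then have "\<sigma> * (s + ltree_label D x) \<le> K + 1"
          using X[OF D] by (simp add: algebra_simps)
        then show "measure_pmf.expectation (F D) (?cost x) \<le> ltree_cost D x + 2 / \<kappa> * (K + 1 - \<sigma> * s - ?X D)"
          using k(4)[OF x, of "s + ltree_label D x"] F(4)[OF R(2)[OF D], of x]
          by (simp add: \<sigma>_def algebra_simps)
      qed
      also have "\<dots> = q + 2 / \<kappa> * (K + 1 - \<sigma> * s - \<delta>)" by (simp add: int q_def \<delta>_def)
      also have "\<dots> \<le> 2 / \<kappa> * (K + 1 - \<sigma> * s)"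
      proof -
        \<comment> \<open>Twice the drift covers \<open>\<kappa>\<close> times the queries of the
          round; hence the slope \<open>2 / \<kappa>\<close> of the potential.\<close>
        have "\<kappa> * q \<le> 2 * \<delta>" using pay v0 V by linarith
        then show ?thesis using pos by (simp add: field_simps)
      qed
      finally show "measure_pmf.expectation P (?cost x) \<le> 2 / \<kappa> * (K + 1 - value_sign g x * s)"
        by (simp add: \<sigma>_def)
    qed
  qed
qed

section \<open>The hard distribution\<close>

lemma pmf_map_eq_expectation:
  "pmf (map_pmf f P) b = measure_pmf.expectation P (\<lambda>T. of_bool (f T = b))"
proof -
  have "measure_pmf.expectation P (\<lambda>T. of_bool (f T = b)) = measure_pmf.expectation P (indicator (f -` {b}))"
    by (rule Bochner_Integration.integral_cong) (auto simp: indicator_def)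
  also have "\<dots> = measure_pmf.prob P (f -` {b})" by simp
  finally show ?thesis by (simp only: pmf_map)
qed

lemma finite_dom_partial_boolean_function:
  assumes "partial_boolean_function m g"
  shows "finite (dom g)"
proof -
  have "dom g \<subseteq> {x. set x \<subseteq> UNIV \<and> length x = m}"
    using assms by (auto simp: partial_boolean_function_def)
  then show ?thesis by (rule finite_subset) (rule finite_lists_length_eq[OF finite])
qed

text \<open>The error budget 1/3 is split evenly. With threshold 12 the walk errs with probability
  at most \<open>1/8 + 1/24 = 1/6\<close> and makes at most \<open>26 / \<kappa>\<close> queries in
  expectation; since \<open>156 = 6 * 26\<close>, Markov's inequality bounds the probability of more
  than \<open>d\<close> queries by 1/6.\<close>

lemma positive_payoff_imp_query_bound:
  fixes R :: "ltree pmf"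
  assumes "finite (dom g)"
    and R: "finite (set_pmf R)" "\<And>D. D \<in> set_pmf R \<Longrightarrow> ltree_on m D"
    and pos: "\<And>x. x \<in> dom g \<Longrightarrow> measure_pmf.expectation R (\<lambda>D. payoff \<kappa> g D x) > 0"
    and d: "\<kappa> * (real d + 1) \<ge> 156" "\<kappa> > 0"
  shows "randomized_query_complexity m g \<le> d"
proof -
  \<comment> \<open>The inserted 2 ensures \<open>V \<le> 2\<close> and provides a value for an
    empty domain.\<close>
  define V where "V = Min (insert 2 ((\<lambda>x. measure_pmf.expectation R (\<lambda>D. payoff \<kappa> g D x)) ` dom g))"
  have V: "V > 0" "V \<le> 2" using assms(1) pos by (auto simp: V_def Min_gr_iff)
  have V': "measure_pmf.expectation R (\<lambda>D. payoff \<kappa> g D x) \<ge> V" if "x \<in> dom g" for x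
    unfolding V_def using that assms(1) by (intro Min_le) auto
  obtain N where "(1 - V / 16) ^ N < 1 / (24 * exp 3)"
    using real_arch_pow_inv[of "1 / (24 * exp 3)" "1 - V / 16"] V by auto
  then have N: "(1 - V / 16) ^ N * exp 3 \<le> 1 / 24" by (simp add: field_simps)
  have e3: "exp (- 3) \<le> (1 / 8 :: real)"
  proof -
    have "(2 :: real) ^ 3 \<le> exp 1 ^ 3" using exp_ge_add_one_self[of 1] by (intro power_mono) auto
    also have "\<dots> = exp 3" by (simp add: exp_of_nat_mult[symmetric])
    finally show ?thesis by (simp add: exp_minus field_simps)
  qed
  obtain P where P: "finite (set_pmf P)" "\<And>T. T \<in> set_pmf P \<Longrightarrow> dtree_on m T"
    and err: "\<And>x. x \<in> dom g \<Longrightarrow> measure_pmf.expectation P (\<lambda>T. of_bool (dtree_output T x \<noteq> the (g x))) \<le>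
        exp (- 3) + (1 - V / 16) ^ N * exp 3"
    and cost: "\<And>x. x \<in> dom g \<Longrightarrow> measure_pmf.expectation P (\<lambda>T. real (dtree_cost T x)) \<le> 2 / \<kappa> * 13"
    using amplification_exists[OF R V V' d(2), where K = 12 and s = 0 and N = N] by auto
  define P' where "P' = map_pmf (dtree_truncate d) P"
  have int: "integrable (measure_pmf P) w" for w :: "dtree \<Rightarrow> real"
    using P(1) by (rule integrable_measure_pmf_finite)
  have "pmf (map_pmf (\<lambda>T. dtree_output T x) P') (the (g x)) \<ge> 1 - 1 / 3" if x: "x \<in> dom g" for x
  proof -
    let ?v = "the (g x)"
    \<comment> \<open>Pointwise, a truncated run can fail only through a wrong output of the full
      tree or through at least \<open>d + 1\<close> queries.\<close>
    have "measure_pmf.expectation P (\<lambda>T. 1 - (of_bool (dtree_output T x \<noteq> ?v) + dtree_cost T x / (real d + 1))) \<le>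
      measure_pmf.expectation P (\<lambda>T. of_bool (dtree_output (dtree_truncate d T) x = ?v))"
    proof (rule expectation_mono_finite[OF P(1)])
      fix T
      show "1 - (of_bool (dtree_output T x \<noteq> ?v) + real (dtree_cost T x) / (real d + 1))
        \<le> of_bool (dtree_output (dtree_truncate d T) x = ?v)"
      proof (cases "dtree_cost T x \<le> d")
        case True
        then show ?thesis by (simp add: dtree_truncate_output)
      next
        case False
        then have "real (dtree_cost T x) / (real d + 1) \<ge> 1" by (simp add: field_simps)
        moreover have "of_bool c \<ge> (0::real)" for c by simp
        ultimately show ?thesis by (smt (verit))
      qed
    qed
    moreover have "pmf (map_pmf (\<lambda>T. dtree_output T x) P') ?v =
      measure_pmf.expectation P (\<lambda>T. of_bool (dtree_output (dtree_truncate d T) x = ?v))"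
      by (simp add: P'_def pmf.map_comp o_def pmf_map_eq_expectation)
    moreover have "measure_pmf.expectation P (\<lambda>T. 1 - (of_bool (dtree_output T x \<noteq> ?v) + dtree_cost T x / (real d + 1)))
      = 1 - (measure_pmf.expectation P (\<lambda>T. of_bool (dtree_output T x \<noteq> ?v)) +
          measure_pmf.expectation P (\<lambda>T. real (dtree_cost T x)) / (real d + 1))"
      by (simp add: int del: of_bool_not_iff)
    moreover have "measure_pmf.expectation P (\<lambda>T. real (dtree_cost T x)) / (real d + 1) \<le> 1 / 6"
    proof -
      have "measure_pmf.expectation P (\<lambda>T. real (dtree_cost T x)) / (real d + 1) \<le> (2 / \<kappa> * 13) / (real d + 1)"
        using cost[OF x] by (rule divide_right_mono) simp
      also have "\<dots> \<le> 1 / 6" using d by (simp add: field_simps)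
      finally show ?thesis .
    qed
    ultimately show ?thesis using err[OF x] N e3 by linarith
  qed
  then have "randomized_computes (1/3) P' g" by (simp add: randomized_computes_def)
  moreover have "\<forall>T\<in>set_pmf P'. dtree_on m T \<and> dtree_depth T \<le> d"
    using P(2) by (auto simp: P'_def dtree_truncate_depth dtree_truncate_on)
  ultimately show ?thesis unfolding randomized_query_complexity_def by (intro Least_le) auto
qed

text \<open>Otherwise the theorem of the alternative yields a mixture of trees with positive payoff
  on every input, and \<open>g\<close> is computed with one query less than its complexity.\<close>

lemma hard_distribution_exists:
  assumes "finite (dom g)" and r: "randomized_query_complexity m g > 0"
  defines "\<kappa> \<equiv> 156 / real (randomized_query_complexity m g)"
  obtains \<mu> where "\<And>x. \<mu> x \<ge> 0" "(\<Sum>x\<in>dom g. \<mu> x) = 1"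
    "\<And>D. ltree_on m D \<Longrightarrow> (\<Sum>x\<in>dom g. \<mu> x * payoff \<kappa> g D x) \<le> 0"
proof -
  define U where "U = (\<lambda>R x. measure_pmf.expectation R (\<lambda>D. payoff \<kappa> g D x)) `
    {R. finite (set_pmf R) \<and> (\<forall>D\<in>set_pmf R. ltree_on m D)}"
  have single: "payoff \<kappa> g D \<in> U" if "ltree_on m D" for D
    unfolding U_def using that by (intro image_eqI[of _ _ "return_pmf D"]) auto
  have "U \<noteq> {}" using single[of "LLeaf 0"] by auto
  moreover have "(\<lambda>i. (1 - t) * u i + t * v i) \<in> U"
    if "u \<in> U" "v \<in> U" "0 \<le> t" "t \<le> 1" for u v t
  proof -
    from that obtain A B where
      A: "finite (set_pmf A)" "\<forall>D\<in>set_pmf A. ltree_on m D" "u = (\<lambda>x. measure_pmf.expectation A (\<lambda>D. payoff \<kappa> g D x))" and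
      B: "finite (set_pmf B)" "\<forall>D\<in>set_pmf B. ltree_on m D" "v = (\<lambda>x. measure_pmf.expectation B (\<lambda>D. payoff \<kappa> g D x))"
      unfolding U_def by auto
    show ?thesis unfolding U_def
    proof (rule image_eqI[of _ _ "mix_pmf t A B"])
      show "(\<lambda>i. (1 - t) * u i + t * v i) = (\<lambda>x. measure_pmf.expectation (mix_pmf t A B) (\<lambda>D. payoff \<kappa> g D x))"
        using A B that by (simp add: expectation_mix_pmf)
      show "mix_pmf t A B \<in> {R. finite (set_pmf R) \<and> (\<forall>D\<in>set_pmf R. ltree_on m D)}"
        using A B set_mix_pmf_subset[of t A B] finite_subset[of _ "set_pmf A \<union> set_pmf B"] by auto
    qed
  qed
  ultimately consider (pos) u where "u \<in> U" "\<forall>x\<in>dom g. u x > 0" |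
    (dual) \<mu> where "\<forall>x. \<mu> x \<ge> 0" "(\<Sum>x\<in>dom g. \<mu> x) = 1" "\<forall>u\<in>U. (\<Sum>x\<in>dom g. \<mu> x * u x) \<le> 0"
    using positive_or_dual_certificate[OF assms(1), of U] by blast
  then show thesis
  proof cases
    case pos
    then obtain R where "finite (set_pmf R)" "\<And>D. D \<in> set_pmf R \<Longrightarrow> ltree_on m D"
      "\<And>x. x \<in> dom g \<Longrightarrow> measure_pmf.expectation R (\<lambda>D. payoff \<kappa> g D x) > 0"
      unfolding U_def by auto
    \<comment> \<open>The bound is applied with \<open>d\<close> one less than the complexity, so
      that \<open>\<kappa> * (d + 1)\<close> is exactly 156.\<close>
    moreover have "\<kappa> * (real (randomized_query_complexity m g - 1) + 1) \<ge> 156" "\<kappa> > 0"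
      using r by (simp_all add: \<kappa>_def of_nat_diff)
    ultimately have "randomized_query_complexity m g \<le> randomized_query_complexity m g - 1"
      by (rule positive_payoff_imp_query_bound[OF assms(1)])
    then show thesis using r by simp
  next
    case dual
    then show thesis using single that by blast
  qed
qed

section \<open>Weights of the two values and the value function of the game\<close>

definition value_weight :: "(bool list \<rightharpoonup> bool) \<Rightarrow> (bool list \<Rightarrow> real) \<Rightarrow> bool \<Rightarrow> bool list set \<Rightarrow> real" where
  "value_weight g \<mu> b H = (\<Sum>x | x \<in> H \<and> g x = Some b. \<mu> x)"

lemma value_weight_nonneg: "(\<And>x. \<mu> x \<ge> 0) \<Longrightarrow> value_weight g \<mu> b H \<ge> 0"
  by (simp add: value_weight_def sum_nonneg)

lemma value_weight_split:
  assumes "finite H"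
  shows "value_weight g \<mu> b H = value_weight g \<mu> b {x \<in> H. \<not> x ! p} + value_weight g \<mu> b {x \<in> H. x ! p}"
proof -
  have "{x. x \<in> H \<and> g x = Some b} =
      {x. x \<in> {x \<in> H. \<not> x ! p} \<and> g x = Some b} \<union> {x. x \<in> {x \<in> H. x ! p} \<and> g x = Some b}"
    by blast
  then show ?thesis unfolding value_weight_def using assms
    by (simp add: sum.union_disjoint Int_def)
qed

lemma sum_value_split:
  assumes "finite H" "H \<subseteq> dom g"
  shows "(\<Sum>x\<in>H. h x) = (\<Sum>x | x \<in> H \<and> g x = Some True. h x) + (\<Sum>x | x \<in> H \<and> g x = Some False. (h x :: real))"
proof -
  have "g x = Some True \<or> g x = Some False" if "x \<in> H" for x
    using that assms(2) by (cases "the (g x)") force+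
  then have "H = {x. x \<in> H \<and> g x = Some True} \<union> {x. x \<in> H \<and> g x = Some False}" by blast
  moreover have "finite {x. x \<in> H \<and> g x = Some True}" "finite {x. x \<in> H \<and> g x = Some False}"
    using assms(1) by simp_all
  moreover have "{x. x \<in> H \<and> g x = Some True} \<inter> {x. x \<in> H \<and> g x = Some False} = {}" by auto
  ultimately show ?thesis using sum.union_disjoint[of _ _ h] by metis
qed

lemma leaf_payoff_sum:
  assumes "finite H" "H \<subseteq> dom g"
  shows "(\<Sum>x\<in>H. \<mu> x * payoff \<kappa> g (LLeaf a) x) =
    2 * a * (value_weight g \<mu> True H - value_weight g \<mu> False H)
      - a\<^sup>2 * (value_weight g \<mu> True H + value_weight g \<mu> False H)"
proof -
  have "(\<Sum>x | x \<in> H \<and> g x = Some True. \<mu> x * payoff \<kappa> g (LLeaf a) x) =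
      (\<Sum>x | x \<in> H \<and> g x = Some True. \<mu> x * (2 * a - a\<^sup>2))"
    by (rule sum.cong) (auto simp: payoff_def value_sign_def)
  moreover have "(\<Sum>x | x \<in> H \<and> g x = Some False. \<mu> x * payoff \<kappa> g (LLeaf a) x) =
      (\<Sum>x | x \<in> H \<and> g x = Some False. \<mu> x * (- 2 * a - a\<^sup>2))"
    by (rule sum.cong) (auto simp: payoff_def value_sign_def)
  ultimately show ?thesis
    unfolding sum_value_split[OF assms] value_weight_def
    by (simp add: sum_distrib_right[symmetric]) (simp add: algebra_simps)
qed

text \<open>A single leaf labelled by the bias of \<open>\<mu>\<close> earns the square of that bias
  without any query.\<close>

lemma balanced_if_leaf_payoffs_nonpos:
  assumes "finite (dom g)" "\<And>x. \<mu> x \<ge> 0" "(\<Sum>x\<in>dom g. \<mu> x) = 1"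
    and "\<And>a. \<bar>a\<bar> \<le> 1 \<Longrightarrow> (\<Sum>x\<in>dom g. \<mu> x * payoff \<kappa> g (LLeaf a) x) \<le> 0"
  shows "value_weight g \<mu> b (dom g) = 1 / 2"
proof -
  let ?t = "value_weight g \<mu> True (dom g)" and ?f = "value_weight g \<mu> False (dom g)"
  have sum: "?t + ?f = 1"
    using sum_value_split[OF assms(1) order_refl, of \<mu>] assms(3) by (simp add: value_weight_def)
  have nn: "?t \<ge> 0" "?f \<ge> 0" using assms(2) by (auto intro: value_weight_nonneg)
  have "2 * (?t - ?f) * (?t - ?f) - (?t - ?f)\<^sup>2 * (?t + ?f) \<le> 0"
    using assms(4)[of "?t - ?f"] leaf_payoff_sum[OF assms(1) order_refl, of \<mu> \<kappa> "?t - ?f"] sum nn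
    by simp
  then have "(?t - ?f)\<^sup>2 \<le> 0" unfolding sum by (simp add: power2_eq_square left_diff_distrib)
  then have "?t = ?f" by simp
  then show ?thesis using sum by (cases b) auto
qed

text \<open>
  The optimal payoff attainable once the input is known to lie in \<open>H\<close>; the second and third properties
  are the Bellman inequalities of the optimisation over labelled trees.
\<close>

lemma optimal_payoff_exists:
  assumes fin: "finite (dom g)" and \<mu>: "\<And>x. \<mu> x \<ge> 0" "\<kappa> > 0"
    "\<And>D. ltree_on m D \<Longrightarrow> (\<Sum>x\<in>dom g. \<mu> x * payoff \<kappa> g D x) \<le> 0"
  obtains \<Phi> where "\<Phi> (dom g) \<le> 0"
    "\<And>H. H \<subseteq> dom g \<Longrightarrow> bias_value (value_weight g \<mu> True H) (value_weight g \<mu> False H) \<le> \<Phi> H"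
    "\<And>H p. H \<subseteq> dom g \<Longrightarrow> p < m \<Longrightarrow> \<Phi> {x \<in> H. \<not> x ! p} + \<Phi> {x \<in> H. x ! p} \<le>
       \<Phi> H + \<kappa> * (value_weight g \<mu> True H + value_weight g \<mu> False H)"
proof -
  define pay where "pay H D = (\<Sum>x\<in>H. \<mu> x * payoff \<kappa> g D x)" for H D
  define \<Phi> where "\<Phi> H = (SUP D\<in>Collect (ltree_on m). pay H D)" for H
  have ne: "Collect (ltree_on m) \<noteq> {}" by (auto intro: exI[of _ "LLeaf 0"])
  have bdd: "bdd_above (pay H ` Collect (ltree_on m))" if "H \<subseteq> dom g" for H
  proof (rule bdd_aboveI2)
    fix D
    show "pay H D \<le> (\<Sum>x\<in>H. \<mu> x * 1)"
      unfolding pay_def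
    proof (intro sum_mono mult_left_mono)
      fix x
      \<comment> \<open>Completing the square: as the sign squares to 1, the payoff is 1 minus this
        nonnegative quantity.\<close>
      have "0 \<le> (value_sign g x - ltree_label D x)\<^sup>2 + \<kappa> * ltree_cost D x" using \<mu>(2) by simp
      then show "payoff \<kappa> g D x \<le> 1"
        by (auto simp: payoff_def value_sign_def power2_eq_square algebra_simps split: if_splits)
    qed (rule \<mu>(1))
  qed
  have le: "pay H D \<le> \<Phi> H" if "H \<subseteq> dom g" "ltree_on m D" for H D
    unfolding \<Phi>_def using that bdd by (intro cSUP_upper) auto
  have "\<Phi> (dom g) \<le> 0"
    unfolding \<Phi>_def pay_def using ne \<mu>(3) by (intro cSUP_least) auto
  moreover have "bias_value (value_weight g \<mu> True H) (value_weight g \<mu> False H) \<le> \<Phi> H" if H: "H \<subseteq> dom g" for H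
  proof -
    let ?t = "value_weight g \<mu> True H" and ?f = "value_weight g \<mu> False H"
    let ?a = "(?t - ?f) / (?t + ?f)"
    have nn: "?t \<ge> 0" "?f \<ge> 0" using \<mu>(1) by (auto intro: value_weight_nonneg)
    have "bias_value ?t ?f = 2 * ?a * (?t - ?f) - ?a\<^sup>2 * (?t + ?f)"
      by (simp add: bias_value_def power2_eq_square)
    also have "\<dots> = pay H (LLeaf ?a)"
      unfolding pay_def using H fin finite_subset by (subst leaf_payoff_sum) auto
    also have "\<dots> \<le> \<Phi> H"
      using nn by (intro le[OF H]) (auto simp: abs_if divide_simps)
    finally show ?thesis .
  qed
  moreover have "\<Phi> {x \<in> H. \<not> x ! p} + \<Phi> {x \<in> H. x ! p} \<le>
      \<Phi> H + \<kappa> * (value_weight g \<mu> True H + value_weight g \<mu> False H)" if H: "H \<subseteq> dom g" and "p < m" for H p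
  proof -
    let ?w = "value_weight g \<mu> True H + value_weight g \<mu> False H"
    have finH: "finite H" using H fin finite_subset by blast
    have w: "?w = (\<Sum>x\<in>H. \<mu> x)"
      using sum_value_split[OF finH H, of \<mu>] by (simp add: value_weight_def)
    have step: "pay {x \<in> H. \<not> x ! p} l + pay {x \<in> H. x ! p} r \<le> \<Phi> H + \<kappa> * ?w"
      if "ltree_on m l" "ltree_on m r" for l r
    proof -
      have "pay H (LQuery p l r) = (\<Sum>x\<in>{x \<in> H. \<not> x ! p} \<union> {x \<in> H. x ! p}. \<mu> x * payoff \<kappa> g (LQuery p l r) x)"
        unfolding pay_def by (rule sum.cong) auto
      also have "\<dots> = (\<Sum>x\<in>{x \<in> H. \<not> x ! p}. \<mu> x * payoff \<kappa> g (LQuery p l r) x) +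
          (\<Sum>x\<in>{x \<in> H. x ! p}. \<mu> x * payoff \<kappa> g (LQuery p l r) x)"
        using finH by (intro sum.union_disjoint) auto
      also have "(\<Sum>x\<in>{x \<in> H. \<not> x ! p}. \<mu> x * payoff \<kappa> g (LQuery p l r) x) =
          (\<Sum>x\<in>{x \<in> H. \<not> x ! p}. \<mu> x * payoff \<kappa> g l x - \<kappa> * \<mu> x)"
        by (rule sum.cong) (auto simp: payoff_def algebra_simps)
      also have "(\<Sum>x\<in>{x \<in> H. x ! p}. \<mu> x * payoff \<kappa> g (LQuery p l r) x) =
          (\<Sum>x\<in>{x \<in> H. x ! p}. \<mu> x * payoff \<kappa> g r x - \<kappa> * \<mu> x)"
        by (rule sum.cong) (auto simp: payoff_def algebra_simps)
      finally have "pay H (LQuery p l r) = pay {x \<in> H. \<not> x ! p} l + pay {x \<in> H. x ! p} r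
          - \<kappa> * ((\<Sum>x\<in>{x \<in> H. \<not> x ! p}. \<mu> x) + (\<Sum>x\<in>{x \<in> H. x ! p}. \<mu> x))"
        by (simp add: pay_def sum_subtractf sum_distrib_left algebra_simps)
      also have "(\<Sum>x\<in>{x \<in> H. \<not> x ! p}. \<mu> x) + (\<Sum>x\<in>{x \<in> H. x ! p}. \<mu> x) = ?w"
        unfolding w using finH sum.union_disjoint[of "{x \<in> H. \<not> x ! p}" "{x \<in> H. x ! p}" \<mu>]
        by (simp add: disjoint_iff Collect_disj_eq[symmetric] conj_disj_distribL[symmetric])
      finally show ?thesis using le[OF H, of "LQuery p l r"] that \<open>p < m\<close> by simp
    qed
    \<comment> \<open>The suprema over the two subtrees are taken one after the other, first over
      \<open>r\<close>, then over \<open>l\<close>.\<close>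
    have "\<Phi> {x \<in> H. x ! p} \<le> \<Phi> H + \<kappa> * ?w - pay {x \<in> H. \<not> x ! p} l" if "ltree_on m l" for l
      unfolding \<Phi>_def[of "{x \<in> H. x ! p}"] using ne step[OF that] by (intro cSUP_least) (auto simp: algebra_simps)
    then have "pay {x \<in> H. \<not> x ! p} l \<le> \<Phi> H + \<kappa> * ?w - \<Phi> {x \<in> H. x ! p}" if "ltree_on m l" for l
      using that by (simp add: algebra_simps)
    then have "\<Phi> {x \<in> H. \<not> x ! p} \<le> \<Phi> H + \<kappa> * ?w - \<Phi> {x \<in> H. x ! p}"
      unfolding \<Phi>_def[of "{x \<in> H. \<not> x ! p}"] using ne by (intro cSUP_least) auto
    then show ?thesis by linarith
  qed
  ultimately show thesis by (rule that)
qed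

section \<open>Noisy oracle algorithms\<close>

lemma finite_noisy_tree_run: "finite (set_pmf (noisy_tree_run T z))"
  by (induction T) (auto simp: noisy_oracle_def split: if_splits)

abbreviation acceptance :: "noisy_tree pmf \<Rightarrow> bool list \<Rightarrow> bool \<Rightarrow> real" where
  "acceptance R z b \<equiv> pmf (map_pmf fst (noisy_run R z)) b"

lemma acceptance_eq_expectation:
  assumes "finite (set_pmf R)"
  shows "acceptance R z b = measure_pmf.expectation R (\<lambda>T.
    measure_pmf.expectation (noisy_tree_run T z) (\<lambda>t. of_bool (fst t = b)))"
  unfolding pmf_map_eq_expectation noisy_run_def using assms
  by (intro expectation_bind_finite finite_noisy_tree_run)

lemma noisy_cost_eq_expectation:
  assumes "finite (set_pmf R)"
  shows "noisy_cost R z = measure_pmf.expectation R (\<lambda>T.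
    measure_pmf.expectation (noisy_tree_run T z) snd)"
  unfolding noisy_cost_def noisy_run_def using assms
  by (intro expectation_bind_finite finite_noisy_tree_run)

text \<open>As \<open>h\<close> sees both the output and the cost, one formula serves for acceptance
  probabilities and for expected costs.\<close>

lemma expectation_noisy_query:
  assumes "0 \<le> \<gamma>" "\<gamma> \<le> 1"
  shows "measure_pmf.expectation (noisy_tree_run (NQuery i \<gamma> l r) z) h =
    (1 - (if z ! i then \<gamma> else - \<gamma>)) / 2 *
       measure_pmf.expectation (noisy_tree_run l z) (\<lambda>t. h (fst t, \<gamma>\<^sup>2 + snd t)) +
    (1 + (if z ! i then \<gamma> else - \<gamma>)) / 2 *
       measure_pmf.expectation (noisy_tree_run r z) (\<lambda>t. (h (fst t, \<gamma>\<^sup>2 + snd t) :: real))"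
proof -
  have "0 \<le> (1 + \<gamma>) / 2" "(1 + \<gamma>) / 2 \<le> 1" using assms by auto
  moreover have "1 - (1 + \<gamma>) / 2 = (1 - \<gamma>) / 2" by (simp add: field_simps)
  ultimately show ?thesis
    by (simp add: expectation_bind_finite finite_noisy_tree_run noisy_oracle_def case_prod_unfold
        finite_subset[OF subset_UNIV]) (auto simp: field_simps)
qed

lemma noisy_query_exists_nonneg:
  assumes "i < n" "0 \<le> \<gamma>" "\<gamma> \<le> 1" "noisy_algorithm n A" "noisy_algorithm n B"
  shows "\<exists>R. noisy_algorithm n R \<and>
    (\<forall>z b. acceptance R z b = (1 - (if z ! i then \<gamma> else - \<gamma>)) / 2 * acceptance A z b +
        (1 + (if z ! i then \<gamma> else - \<gamma>)) / 2 * acceptance B z b) \<and>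
    (\<forall>z. noisy_cost R z = \<gamma>\<^sup>2 + (1 - (if z ! i then \<gamma> else - \<gamma>)) / 2 * noisy_cost A z +
        (1 + (if z ! i then \<gamma> else - \<gamma>)) / 2 * noisy_cost B z)"
proof -
  define R where "R = bind_pmf A (\<lambda>l. map_pmf (NQuery i \<gamma> l) B)"
  have fin: "finite (set_pmf A)" "finite (set_pmf B)"
    using assms by (auto simp: noisy_algorithm_def)
  have R: "noisy_algorithm n R"
    using assms by (auto simp: noisy_algorithm_def R_def)
  then have finR: "finite (set_pmf R)" by (simp add: noisy_algorithm_def)
  have E: "measure_pmf.expectation R w =
    measure_pmf.expectation A (\<lambda>l. measure_pmf.expectation B (\<lambda>r. w (NQuery i \<gamma> l r)))" for w :: "noisy_tree \<Rightarrow> real"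
    unfolding R_def using fin by (subst expectation_bind_finite) auto
  have int: "integrable (measure_pmf A) w" "integrable (measure_pmf B) w" for w :: "noisy_tree \<Rightarrow> real"
    using fin by (auto intro: integrable_measure_pmf_finite)
  have int': "integrable (measure_pmf (noisy_tree_run T z)) w" for T z and w :: "bool \<times> real \<Rightarrow> real"
    by (intro integrable_measure_pmf_finite finite_noisy_tree_run)
  show ?thesis
  proof (intro exI[of _ R] conjI allI)
    fix z b
    show "acceptance R z b = (1 - (if z ! i then \<gamma> else - \<gamma>)) / 2 * acceptance A z b +
      (1 + (if z ! i then \<gamma> else - \<gamma>)) / 2 * acceptance B z b"
      unfolding acceptance_eq_expectation[OF finR] acceptance_eq_expectation[OF fin(1)]
        acceptance_eq_expectation[OF fin(2)] E expectation_noisy_query[OF assms(2,3)]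
      by (simp add: int)
    show "noisy_cost R z = \<gamma>\<^sup>2 + (1 - (if z ! i then \<gamma> else - \<gamma>)) / 2 * noisy_cost A z +
      (1 + (if z ! i then \<gamma> else - \<gamma>)) / 2 * noisy_cost B z"
      unfolding noisy_cost_eq_expectation[OF finR] noisy_cost_eq_expectation[OF fin(1)]
        noisy_cost_eq_expectation[OF fin(2)] E expectation_noisy_query[OF assms(2,3)]
      by (simp add: int int') (simp add: field_simps)
  qed (rule R)
qed

text \<open>A negative \<open>\<gamma>\<close> stands for a query with inverted answer, obtained by
  exchanging the two continuations.\<close>

lemma noisy_query_exists:
  assumes "i < n" "\<bar>\<gamma>\<bar> \<le> 1" "noisy_algorithm n A" "noisy_algorithm n B"
  shows "\<exists>R. noisy_algorithm n R \<and>
    (\<forall>z b. acceptance R z b = (1 - (if z ! i then \<gamma> else - \<gamma>)) / 2 * acceptance A z b +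
        (1 + (if z ! i then \<gamma> else - \<gamma>)) / 2 * acceptance B z b) \<and>
    (\<forall>z. noisy_cost R z = \<gamma>\<^sup>2 + (1 - (if z ! i then \<gamma> else - \<gamma>)) / 2 * noisy_cost A z +
        (1 + (if z ! i then \<gamma> else - \<gamma>)) / 2 * noisy_cost B z)"
proof (cases "\<gamma> \<ge> 0")
  case True
  then show ?thesis using noisy_query_exists_nonneg[of i n \<gamma> A B] assms by auto
next
  case False
  then obtain R where R: "noisy_algorithm n R"
    "\<And>z b. acceptance R z b = (1 - (if z ! i then - \<gamma> else \<gamma>)) / 2 * acceptance B z b +
      (1 + (if z ! i then - \<gamma> else \<gamma>)) / 2 * acceptance A z b"
    "\<And>z. noisy_cost R z = \<gamma>\<^sup>2 + (1 - (if z ! i then - \<gamma> else \<gamma>)) / 2 * noisy_cost B z +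
      (1 + (if z ! i then - \<gamma> else \<gamma>)) / 2 * noisy_cost A z"
    using noisy_query_exists_nonneg[of i n "- \<gamma>" B A] assms by auto
  then show ?thesis by (intro exI[of _ R]) (auto simp: algebra_simps)
qed

lemma noisy_mix:
  assumes "noisy_algorithm n A" "noisy_algorithm n B" "0 \<le> t" "t \<le> 1"
  shows "noisy_algorithm n (mix_pmf t A B)"
    and "acceptance (mix_pmf t A B) z b = (1 - t) * acceptance A z b + t * acceptance B z b"
    and "noisy_cost (mix_pmf t A B) z = (1 - t) * noisy_cost A z + t * noisy_cost B z"
proof -
  have fin: "finite (set_pmf A)" "finite (set_pmf B)"
    using assms by (auto simp: noisy_algorithm_def)
  have fin': "finite (set_pmf (mix_pmf t A B))"
    using fin set_mix_pmf_subset[of t A B] finite_subset by blast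
  show "noisy_algorithm n (mix_pmf t A B)"
    using assms fin' set_mix_pmf_subset[of t A B] by (auto simp: noisy_algorithm_def)
  show "acceptance (mix_pmf t A B) z b = (1 - t) * acceptance A z b + t * acceptance B z b"
    using fin fin' assms by (simp only: acceptance_eq_expectation expectation_mix_pmf)
  show "noisy_cost (mix_pmf t A B) z = (1 - t) * noisy_cost A z + t * noisy_cost B z"
    using fin fin' assms by (simp only: noisy_cost_eq_expectation expectation_mix_pmf)
qed

text \<open>
  A bit that is 1 with probability \<open>p (z ! i)\<close> is obtained from one noisy query made only with
  probability \<open>r\<close>; otherwise the likelier answer is given for free. Doing so lowers the cost from
  \<open>\<gamma>\<^sup>2 = (p True - p False)\<^sup>2 / r\<^sup>2\<close> to \<open>r \<gamma>\<^sup>2\<close>, which is comparable to the gain in squared bias.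
\<close>

lemma noisy_answer_exists:
  fixes p :: "bool \<Rightarrow> real"
  assumes "i < n" "noisy_algorithm n A" "noisy_algorithm n B" "\<And>c. 0 \<le> p c" "\<And>c. p c \<le> 1"
  defines "r \<equiv> min (p True + p False) (2 - p True - p False)"
  shows "\<exists>R. noisy_algorithm n R \<and>
    (\<forall>z b. acceptance R z b = (1 - p (z ! i)) * acceptance A z b + p (z ! i) * acceptance B z b) \<and>
    (\<forall>z. noisy_cost R z = (p True - p False)\<^sup>2 / r +
        (1 - p (z ! i)) * noisy_cost A z + p (z ! i) * noisy_cost B z)"
proof -
  define \<gamma> where "\<gamma> = (p True - p False) / r"
  have p: "0 \<le> p True" "p True \<le> 1" "0 \<le> p False" "p False \<le> 1" using assms by auto
  have r: "0 \<le> r" "r \<le> 1" using p by (auto simp: r_def min_def)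
  have diff: "\<bar>p True - p False\<bar> \<le> r" using p by (auto simp: r_def min_def abs_if)
  have "\<bar>\<gamma>\<bar> \<le> 1" using diff r by (auto simp: \<gamma>_def divide_le_eq_1)
  then obtain Q where Q: "noisy_algorithm n Q"
    "\<And>z b. acceptance Q z b = (1 - (if z ! i then \<gamma> else - \<gamma>)) / 2 * acceptance A z b +
        (1 + (if z ! i then \<gamma> else - \<gamma>)) / 2 * acceptance B z b"
    "\<And>z. noisy_cost Q z = \<gamma>\<^sup>2 + (1 - (if z ! i then \<gamma> else - \<gamma>)) / 2 * noisy_cost A z +
        (1 + (if z ! i then \<gamma> else - \<gamma>)) / 2 * noisy_cost B z"
    using noisy_query_exists[of i n \<gamma> A B] assms by blast
  \<comment> \<open>If \<open>r = 0\<close>, then \<open>diff\<close> gives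
    \<open>p True = p False\<close>, and this equation and the next hold with
    \<open>\<gamma> = 0\<close>.\<close>
  have r\<gamma>: "r * \<gamma> = p True - p False" using diff by (auto simp: \<gamma>_def)
  have r\<gamma>2: "r * \<gamma>\<^sup>2 = (p True - p False)\<^sup>2 / r" by (auto simp: \<gamma>_def power2_eq_square)
  \<comment> \<open>Here \<open>\<gamma>'\<close> is the price of the query: 0 when the identity is
    applied to acceptance, \<open>\<gamma>\<^sup>2\<close> when it is applied to cost.\<close>
  have mix: "r * (\<gamma>' + (1 - s) / 2 * a + (1 + s) / 2 * b') + (1 - r) * (if p True + p False \<le> 1 then a else b')
      = r * \<gamma>' + (1 - p c) * a + p c * b'" if "s = (if c then \<gamma> else - \<gamma>)" for \<gamma>' s a b' c
  proof -
    have rs: "r * s = (if c then p True - p False else p False - p True)"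
      using r\<gamma> by (simp add: that)
    have "r * (\<gamma>' + (1 - s) / 2 * a + (1 + s) / 2 * b') = r * \<gamma>' + (r - r * s) / 2 * a + (r + r * s) / 2 * b'"
      by (simp add: field_simps)
    then show ?thesis unfolding rs
      by (cases c) (auto simp: r_def min_def field_simps)
  qed
  define R where "R = mix_pmf r (if p True + p False \<le> 1 then A else B) Q"
  have AB: "noisy_algorithm n (if p True + p False \<le> 1 then A else B)" using assms by simp
  show ?thesis
  proof (intro exI[of _ R] conjI allI)
    show "noisy_algorithm n R" unfolding R_def by (rule noisy_mix(1)[OF AB Q(1) r])
    fix z b
    show "acceptance R z b = (1 - p (z ! i)) * acceptance A z b + p (z ! i) * acceptance B z b"
      using mix[of "if z ! i then \<gamma> else - \<gamma>" "z ! i" 0 "acceptance A z b" "acceptance B z b"]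
      unfolding R_def noisy_mix(2)[OF AB Q(1) r] Q(2) by (auto simp: algebra_simps)
    show "noisy_cost R z = (p True - p False)\<^sup>2 / r +
        (1 - p (z ! i)) * noisy_cost A z + p (z ! i) * noisy_cost B z"
      using mix[of "if z ! i then \<gamma> else - \<gamma>" "z ! i" "\<gamma>\<^sup>2" "noisy_cost A z" "noisy_cost B z"] r\<gamma>2
      unfolding R_def noisy_mix(3)[OF AB Q(1) r] Q(3) by (auto simp: algebra_simps)
  qed
qed

section \<open>Positions in a concatenation of blocks\<close>

lemma length_concat_blocks:
  assumes "\<And>i. i < n \<Longrightarrow> length (x i) = m"
  shows "length (concat (map x [0..<n])) = n * m"
  using assms by (induction n) auto

lemma nth_concat_blocks:
  assumes "\<And>i. i < n \<Longrightarrow> length (x i) = m" "j < n * m"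
  shows "concat (map x [0..<n]) ! j = x (j div m) ! (j mod m)"
  using assms
proof (induction n)
  case (Suc n)
  have len: "length (concat (map x [0..<n])) = n * m"
    using Suc.prems by (intro length_concat_blocks) auto
  show ?case
  proof (cases "j < n * m")
    case True
    then show ?thesis using Suc len by (simp add: nth_append)
  next
    case False
    have "j - n * m < m" using False Suc.prems by simp
    moreover have j: "j = m * n + (j - n * m)" using False by simp
    ultimately have "j div m = n" "j mod m = j - n * m"
      by (metis add.commute add_0 div_less div_mult_self2 gr_implies_not0)
        (metis \<open>j - n * m < m\<close> j add.commute mod_less mod_mult_self2)
    then show ?thesis using len False by (simp add: nth_append)
  qed
qed simp

section \<open>Simulating a block by noisy queries\<close>

text \<open>Knowledge about a block is a set \<open>H\<close> of inputs of \<open>g\<close>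
  consistent with the answers so far. The function \<open>\<Phi>\<close> abstracts the value of the
  game continued from \<open>H\<close>, given through its Bellman inequalities.\<close>

locale block_simulation =
  fixes n m :: nat and g :: "bool list \<rightharpoonup> bool" and \<mu> :: "bool list \<Rightarrow> real" and \<kappa> :: real
    and \<Phi> :: "bool list set \<Rightarrow> real"
  assumes dom_g: "partial_boolean_function m g"
    and mu_nonneg: "\<mu> x \<ge> 0"
    and kappa_nonneg: "\<kappa> \<ge> 0"
    and Phi_ge: "H \<subseteq> dom g \<Longrightarrow> bias_value (value_weight g \<mu> True H) (value_weight g \<mu> False H) \<le> \<Phi> H"
    and Phi_split: "H \<subseteq> dom g \<Longrightarrow> p < m \<Longrightarrow> \<Phi> {x \<in> H. \<not> x ! p} + \<Phi> {x \<in> H. x ! p} \<le>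
       \<Phi> H + \<kappa> * (value_weight g \<mu> True H + value_weight g \<mu> False H)"
begin

abbreviation weight :: "bool \<Rightarrow> bool list set \<Rightarrow> real" where
  "weight \<equiv> value_weight g \<mu>"

definition bias :: "bool list set \<Rightarrow> real" where
  "bias H = bias_value (weight True H) (weight False H)"

definition determined :: "bool list set \<Rightarrow> bool" where
  "determined H \<longleftrightarrow> weight True H = 0 \<or> weight False H = 0"

text \<open>Odds of at most two to one, that is a bias of at most 1/3; in this range
  \<open>bias_value_gain\<close> applies.\<close>

definition undecided :: "bool list set \<Rightarrow> bool" where
  "undecided H \<longleftrightarrow> weight True H \<le> 2 * weight False H \<and> weight False H \<le> 2 * weight True H"

text \<open>
  An upper bound on the expected cost still to be paid for a block known to lie in \<open>H\<close>, in addition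
  to \<open>42 \<kappa>\<close> per query, if the value of the block is \<open>b\<close>. Dividing by the weight of \<open>b\<close> accounts for
  the change of measure from \<open>\<mu>\<close> to \<open>\<mu>\<close> conditioned on \<open>b\<close>. A block that is neither determined nor undecided
  is going to be resolved by a noiseless query, of cost 1.
\<close>

definition potential :: "bool \<Rightarrow> bool list set \<Rightarrow> real" where
  "potential b H = (if determined H then 0
     else if undecided H then (14 * \<Phi> H - 5 * bias H) / weight b H else 1)"

lemma finite_dom: "finite (dom g)"
  by (rule finite_dom_partial_boolean_function[OF dom_g])

lemma finite_subset_dom: "H \<subseteq> dom g \<Longrightarrow> finite H"
  using finite_dom finite_subset by blast

lemma weight_nonneg: "weight b H \<ge> 0"
  using mu_nonneg by (rule value_weight_nonneg)

lemma bias_nonneg: "bias H \<ge> 0"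
  using weight_nonneg by (simp add: bias_def bias_value_def)

lemma bias_le_Phi: "H \<subseteq> dom g \<Longrightarrow> bias H \<le> \<Phi> H"
  by (simp add: bias_def Phi_ge)

lemma potential_nonneg: "H \<subseteq> dom g \<Longrightarrow> potential b H \<ge> 0"
  using bias_le_Phi[of H] bias_nonneg[of H] weight_nonneg[of b H] by (simp add: potential_def)

text \<open>The coefficient \<open>14 = 9 + 5\<close> comes from a block awaiting a noiseless query:
  odds beyond two to one mean a squared bias above 1/9, so its weight is at most
  \<open>9 * bias H\<close>, and \<open>bias H \<le> \<Phi> H\<close>.\<close>

lemma weight_potential_le:
  assumes "H \<subseteq> dom g"
  shows "weight b H * potential b H \<le> 14 * \<Phi> H - 5 * bias H"
proof -
  have nn: "0 \<le> 14 * \<Phi> H - 14 * bias H" using bias_le_Phi[OF assms] by simp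
  consider "determined H" | "\<not> determined H" "undecided H" | "\<not> determined H" "\<not> undecided H" by blast
  then show ?thesis
  proof cases
    case 1
    then show ?thesis using nn bias_nonneg[of H] by (simp add: potential_def)
  next
    case 2
    then have "weight b H \<noteq> 0" by (cases b) (auto simp: determined_def)
    then show ?thesis using 2 by (simp add: potential_def)
  next
    case 3
    let ?t = "weight True H" and ?f = "weight False H"
    have pos: "?t > 0" "?f > 0"
      using 3 weight_nonneg[of True H] weight_nonneg[of False H] by (auto simp: determined_def)
    have "((?t + ?f) / 3)\<^sup>2 \<le> (?t - ?f)\<^sup>2"
      unfolding abs_le_square_iff[symmetric] using 3 pos by (auto simp: undecided_def abs_if)
    then have "(?t + ?f)\<^sup>2 \<le> 9 * (?t - ?f)\<^sup>2" by (simp add: power_divide)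
    then have "?t + ?f \<le> 9 * bias H"
      using pos by (simp add: bias_def bias_value_def field_simps power2_eq_square)
    moreover have "weight b H \<le> ?t + ?f" using pos by (cases b) auto
    ultimately show ?thesis using nn 3 by (simp add: potential_def)
  qed
qed

text \<open>
  The conditional probability of the answer 1; if it is undefined for the value \<open>b\<close>, the other value
  is used instead, so that nothing has to be paid for simulating an answer in a determined block.
\<close>

definition answer_prob :: "bool list set \<Rightarrow> nat \<Rightarrow> bool \<Rightarrow> real" where
  "answer_prob H p b = (let c = (if weight b H = 0 then \<not> b else b)
     in weight c {x \<in> H. x ! p} / weight c H)"

definition answer_cost :: "bool list set \<Rightarrow> nat \<Rightarrow> real" where
  "answer_cost H p = (answer_prob H p True - answer_prob H p False)\<^sup>2 /
     min (answer_prob H p True + answer_prob H p False) (2 - answer_prob H p True - answer_prob H p False)"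

lemma weight_split:
  "H \<subseteq> dom g \<Longrightarrow> weight b H = weight b {x \<in> H. \<not> x ! p} + weight b {x \<in> H. x ! p}"
  by (intro value_weight_split finite_subset_dom)

lemma answer_prob_bounds:
  assumes "H \<subseteq> dom g"
  shows "0 \<le> answer_prob H p b" "answer_prob H p b \<le> 1"
proof -
  have "weight c {x \<in> H. x ! p} \<le> weight c H" for c
    using weight_split[OF assms, of c p] weight_nonneg by simp
  then show "answer_prob H p b \<le> 1"
    using weight_nonneg by (auto simp: answer_prob_def Let_def divide_le_eq_1 less_le)
  show "0 \<le> answer_prob H p b" using weight_nonneg by (simp add: answer_prob_def Let_def)
qed

lemma answer_prob_weight: "weight b H > 0 \<Longrightarrow> answer_prob H p b = weight b {x \<in> H. x ! p} / weight b H"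
  by (simp add: answer_prob_def)

lemma answer_prob_weight_compl:
  assumes "weight b H > 0" "H \<subseteq> dom g"
  shows "1 - answer_prob H p b = weight b {x \<in> H. \<not> x ! p} / weight b H"
  using assms weight_split[OF assms(2), of b p] by (simp add: answer_prob_weight field_simps)

lemma weight_subset_zero:
  assumes "weight b H = 0" "H' \<subseteq> H" "H \<subseteq> dom g"
  shows "weight b H' = 0"
proof -
  have "weight b H' \<le> weight b H" unfolding value_weight_def
    using assms finite_subset_dom[OF assms(3)] mu_nonneg by (intro sum_mono2) auto
  then show ?thesis using assms(1) weight_nonneg[of b H'] by simp
qed

text \<open>After multiplication by \<open>weight b H\<close>, the simulated answer costs at most 5
  times the increase of the bias, and the bias of the two halves cancels against the negative terms
  in their potentials. What remains is the growth of \<open>14 * \<Phi>\<close>, at most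
  \<open>14 * \<kappa>\<close> times the total weight.\<close>

lemma potential_step:
  assumes H: "H \<subseteq> dom g" and p: "p < m" and b: "weight b H > 0" and "determined H \<or> undecided H"
  shows "answer_cost H p + (1 - answer_prob H p b) * potential b {x \<in> H. \<not> x ! p}
    + answer_prob H p b * potential b {x \<in> H. x ! p} \<le> potential b H + 42 * \<kappa>"
proof (cases "determined H")
  case True
  then have "determined K" if "K \<subseteq> H" for K
    using weight_subset_zero[OF _ that H] by (auto simp: determined_def)
  then have "determined {x \<in> H. \<not> x ! p}" "determined {x \<in> H. x ! p}" by simp_all
  moreover have "answer_prob H p True = answer_prob H p False"
    using True by (auto simp: answer_prob_def determined_def Let_def)
  ultimately show ?thesis using True kappa_nonneg by (simp add: potential_def answer_cost_def)
next
  case False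
  then have und: "undecided H" using assms by blast
  let ?H0 = "{x \<in> H. \<not> x ! p}" and ?H1 = "{x \<in> H. x ! p}"
  let ?t = "weight True H" and ?f = "weight False H" and ?w = "weight b H"
  let ?P = "answer_prob H p"
  have pos: "?t > 0" "?f > 0"
    using False weight_nonneg[of True H] weight_nonneg[of False H] by (auto simp: determined_def)
  have sub: "?H0 \<subseteq> dom g" "?H1 \<subseteq> dom g" using H by auto
  have P1: "?P c * weight c H = weight c ?H1" and P0: "(1 - ?P c) * weight c H = weight c ?H0" for c
    using pos answer_prob_weight[of c H p] answer_prob_weight_compl[of c H p] H by (cases c; simp)+
  have "answer_cost H p * (?t + ?f) \<le> 5 * (bias_value (?P True * ?t) (?P False * ?f) +
      bias_value ((1 - ?P True) * ?t) ((1 - ?P False) * ?f) - bias_value ?t ?f)"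
    unfolding answer_cost_def using pos und answer_prob_bounds[OF H]
    by (intro bias_value_gain) (auto simp: undecided_def)
  then have gain: "answer_cost H p * (?t + ?f) \<le> 5 * (bias ?H1 + bias ?H0 - bias H)"
    unfolding P0 P1 bias_def .
  have "answer_cost H p \<ge> 0"
    unfolding answer_cost_def using answer_prob_bounds[OF H, of p True] answer_prob_bounds[OF H, of p False] by simp
  moreover have "?w \<le> ?t + ?f" using pos by (cases b) auto
  ultimately have gain': "answer_cost H p * ?w \<le> 5 * (bias ?H1 + bias ?H0 - bias H)"
    using gain mult_left_mono[of ?w "?t + ?f" "answer_cost H p"] by linarith
  have "(answer_cost H p + (1 - ?P b) * potential b ?H0 + ?P b * potential b ?H1) * ?w =
      answer_cost H p * ?w + weight b ?H0 * potential b ?H0 + weight b ?H1 * potential b ?H1"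
    unfolding P0[of b, symmetric] P1[of b, symmetric] by (simp add: algebra_simps)
  also have "\<dots> \<le> 14 * \<Phi> H - 5 * bias H + 14 * (\<kappa> * (?t + ?f))"
    using gain' weight_potential_le[OF sub(1), of b] weight_potential_le[OF sub(2), of b] Phi_split[OF H p]
    by simp
  also have "\<dots> \<le> 14 * \<Phi> H - 5 * bias H + 14 * (\<kappa> * (3 * ?w))"
  proof -
    \<comment> \<open>In an undecided block either value has at least a third of the weight; hence
      \<open>42 = 14 * 3\<close>.\<close>
    have "?t + ?f \<le> 3 * ?w" using und by (cases b) (auto simp: undecided_def)
    then show ?thesis using mult_left_mono[OF _ kappa_nonneg, of "?t + ?f" "3 * ?w"] by linarith
  qed
  also have "\<dots> = (potential b H + 42 * \<kappa>) * ?w"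
    using False und b by (simp add: potential_def field_simps)
  finally show ?thesis using b by simp
qed

section \<open>Inputs of the composition with prescribed block values\<close>

definition fiber :: "(nat \<Rightarrow> bool list set) \<Rightarrow> bool list \<Rightarrow> (nat \<Rightarrow> bool list) set" where
  "fiber Hs z = (\<Pi>\<^sub>E i\<in>{..<n}. {y \<in> Hs i. g y = Some (z ! i)})"

text \<open>For a probability distribution \<open>\<mu>\<close>, the probability that independent
  blocks lie in the fiber and \<open>T\<close> outputs \<open>b\<close>. Left unnormalised, it adds
  up over the two halves of a split block, also where a weight is 0.\<close>

definition output_mass :: "dtree \<Rightarrow> (nat \<Rightarrow> bool list set) \<Rightarrow> bool list \<Rightarrow> bool \<Rightarrow> real" where
  "output_mass T Hs z b = (\<Sum>x\<in>fiber Hs z. (\<Prod>i<n. \<mu> (x i)) *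
     of_bool (dtree_output T (concat (map x [0..<n])) = b))"

lemma fiber_update:
  assumes "i < n"
  shows "fiber (Hs(i := {x \<in> Hs i. P x})) z = {x \<in> fiber Hs z. P (x i)}"
proof (intro set_eqI iffI)
  fix x assume x: "x \<in> fiber (Hs(i := {x \<in> Hs i. P x})) z"
  have "x k \<in> {y \<in> Hs k. g y = Some (z ! k)}" if "k < n" for k
    using PiE_mem[OF x[unfolded fiber_def], of k] that by (cases "k = i") auto
  moreover have "P (x i)" using PiE_mem[OF x[unfolded fiber_def], of i] assms by simp
  moreover have "x \<in> extensional {..<n}" using x by (simp add: fiber_def PiE_def)
  ultimately show "x \<in> {x \<in> fiber Hs z. P (x i)}" by (simp add: fiber_def PiE_iff)
next
  fix x assume "x \<in> {x \<in> fiber Hs z. P (x i)}"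
  then show "x \<in> fiber (Hs(i := {x \<in> Hs i. P x})) z" by (simp add: fiber_def PiE_iff)
qed

lemma fiber_finite: "\<forall>i. Hs i \<subseteq> dom g \<Longrightarrow> finite (fiber Hs z)"
  unfolding fiber_def by (intro finite_PiE finite_Collect_conjI disjI1) (auto intro: finite_subset_dom)

lemma sum_fiber:
  assumes "\<forall>i. Hs i \<subseteq> dom g"
  shows "(\<Sum>x\<in>fiber Hs z. \<Prod>i<n. \<mu> (x i)) = (\<Prod>i<n. weight (z ! i) (Hs i))"
proof -
  have "finite (Hs i)" for i using assms finite_subset_dom by blast
  then show ?thesis unfolding fiber_def value_weight_def by (subst prod_sum_PiE) auto
qed

lemma fiber_length:
  "\<forall>i. Hs i \<subseteq> dom g \<Longrightarrow> x \<in> fiber Hs z \<Longrightarrow> i < n \<Longrightarrow> length (x i) = m"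
  using dom_g PiE_mem[of x "{..<n}" "\<lambda>i. {y \<in> Hs i. g y = Some (z ! i)}" i]
  by (auto simp: fiber_def partial_boolean_function_def)

lemma output_mass_query:
  assumes Hs: "\<forall>i. Hs i \<subseteq> dom g" and j: "j < n * m"
  shows "output_mass (Query j l r) Hs z b =
    output_mass l (Hs(j div m := {x \<in> Hs (j div m). \<not> x ! (j mod m)})) z b +
    output_mass r (Hs(j div m := {x \<in> Hs (j div m). x ! (j mod m)})) z b"
proof -
  let ?i = "j div m" and ?p = "j mod m"
  let ?S = "fiber Hs z"
  have i: "?i < n" using j by (simp add: less_mult_imp_div_less)
  have f0: "fiber (Hs(?i := {x \<in> Hs ?i. \<not> x ! ?p})) z = {x \<in> ?S. \<not> x ?i ! ?p}"
    using i by (rule fiber_update)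
  have f1: "fiber (Hs(?i := {x \<in> Hs ?i. x ! ?p})) z = {x \<in> ?S. x ?i ! ?p}"
    using i by (rule fiber_update)
  let ?h = "\<lambda>T x. (\<Prod>i<n. \<mu> (x i)) * of_bool (dtree_output T (concat (map x [0..<n])) = b)"
  have nth: "concat (map x [0..<n]) ! j = x ?i ! ?p" if "x \<in> ?S" for x
    using fiber_length[OF Hs that] j by (intro nth_concat_blocks) auto
  have "output_mass (Query j l r) Hs z b = (\<Sum>x\<in>{x \<in> ?S. \<not> x ?i ! ?p} \<union> {x \<in> ?S. x ?i ! ?p}. ?h (Query j l r) x)"
    unfolding output_mass_def by (rule sum.cong) auto
  also have "\<dots> = (\<Sum>x\<in>{x \<in> ?S. \<not> x ?i ! ?p}. ?h (Query j l r) x) + (\<Sum>x\<in>{x \<in> ?S. x ?i ! ?p}. ?h (Query j l r) x)"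
    using fiber_finite[OF Hs] by (intro sum.union_disjoint) auto
  also have "(\<Sum>x\<in>{x \<in> ?S. \<not> x ?i ! ?p}. ?h (Query j l r) x) = (\<Sum>x\<in>{x \<in> ?S. \<not> x ?i ! ?p}. ?h l x)"
    using nth by (intro sum.cong) auto
  also have "(\<Sum>x\<in>{x \<in> ?S. x ?i ! ?p}. ?h (Query j l r) x) = (\<Sum>x\<in>{x \<in> ?S. x ?i ! ?p}. ?h r x)"
    using nth by (intro sum.cong) auto
  finally show ?thesis by (simp only: output_mass_def f0 f1)
qed

text \<open>Handles the branch of an answer that is impossible given \<open>z\<close>, about which
  \<open>simulates\<close> promises nothing.\<close>

lemma output_mass_null:
  assumes "\<forall>i. Hs i \<subseteq> dom g" "i < n" "weight (z ! i) (Hs i) = 0"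
  shows "output_mass T Hs z b = 0"
proof -
  have "finite {y. y \<in> Hs i \<and> g y = Some (z ! i)}"
    using assms(1) finite_subset_dom by auto
  then have zero: "\<mu> y = 0" if "y \<in> Hs i" "g y = Some (z ! i)" for y
    using assms(3) mu_nonneg that unfolding value_weight_def
    by (subst (asm) sum_nonneg_eq_0_iff) auto
  show ?thesis unfolding output_mass_def
  proof (intro sum.neutral ballI)
    fix x assume "x \<in> fiber Hs z"
    then have "\<mu> (x i) = 0" using assms(2) zero by (auto simp: fiber_def PiE_iff)
    then have "(\<Prod>i<n. \<mu> (x i)) = 0" using assms(2) by auto
    then show "(\<Prod>i<n. \<mu> (x i)) * of_bool (dtree_output T (concat (map x [0..<n])) = b) = 0" by simp
  qed
qed

text \<open>Only strings \<open>z\<close> compatible with the current knowledge are constrained. For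
  them the output of \<open>R\<close> is distributed exactly as that of \<open>T\<close> on blocks
  drawn from \<open>\<mu>\<close> conditioned on the knowledge and on the values
  \<open>z\<close>.\<close>

definition simulates :: "dtree \<Rightarrow> (nat \<Rightarrow> bool list set) \<Rightarrow> noisy_tree pmf \<Rightarrow> bool" where
  "simulates T Hs R \<longleftrightarrow> noisy_algorithm n R \<and>
    (\<forall>z. (\<forall>i<n. weight (z ! i) (Hs i) > 0) \<longrightarrow>
      (\<forall>b. acceptance R z b * (\<Prod>i<n. weight (z ! i) (Hs i)) = output_mass T Hs z b) \<and>
      noisy_cost R z \<le> (\<Sum>i<n. potential (z ! i) (Hs i)) + 42 * \<kappa> * dtree_depth T)"

text \<open>The answer is drawn with its conditional probability given \<open>z ! i\<close>. The law
  of total probability then yields the output and \<open>potential_step\<close> the cost, as the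
  potentials of the other blocks stay the same.\<close>

lemma simulates_query:
  assumes Hs: "\<forall>i. Hs i \<subseteq> dom g" and j: "j < n * m"
    and clear: "determined (Hs (j div m)) \<or> undecided (Hs (j div m))"
    and A: "simulates l (Hs(j div m := {x \<in> Hs (j div m). \<not> x ! (j mod m)})) A"
    and B: "simulates r (Hs(j div m := {x \<in> Hs (j div m). x ! (j mod m)})) B"
  shows "\<exists>R. simulates (Query j l r) Hs R"
proof -
  define i where "i = j div m"
  define p where "p = j mod m"
  define H where "H = Hs i"
  define H0 where "H0 = {x \<in> H. \<not> x ! p}"
  define H1 where "H1 = {x \<in> H. x ! p}"
  have i: "i < n" using j by (simp add: i_def less_mult_imp_div_less)
  have "p < m" using j by (cases m) (auto simp: p_def)
  have H: "H \<subseteq> dom g" using Hs by (simp add: H_def)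
  have A: "simulates l (Hs(i := H0)) A" and B: "simulates r (Hs(i := H1)) B"
    using A B by (simp_all add: i_def p_def H_def H0_def H1_def)
  have cl: "determined H \<or> undecided H" using clear by (simp add: H_def i_def)
  obtain R where R: "noisy_algorithm n R"
    "\<And>z b. acceptance R z b = (1 - answer_prob H p (z ! i)) * acceptance A z b + answer_prob H p (z ! i) * acceptance B z b"
    "\<And>z. noisy_cost R z = answer_cost H p +
        (1 - answer_prob H p (z ! i)) * noisy_cost A z + answer_prob H p (z ! i) * noisy_cost B z"
    using noisy_answer_exists[of i n A B "answer_prob H p"] i A B answer_prob_bounds[OF H]
    unfolding simulates_def answer_cost_def by blast
  have "simulates (Query j l r) Hs R"
    unfolding simulates_def
  proof (intro conjI allI impI)
    show "noisy_algorithm n R" by (rule R(1))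
    fix z assume z: "\<forall>i<n. weight (z ! i) (Hs i) > 0"
    define w where "w = weight (z ! i) H"
    define w0 where "w0 = weight (z ! i) H0"
    define w1 where "w1 = weight (z ! i) H1"
    define Q where "Q = (\<Prod>k\<in>{..<n} - {i}. weight (z ! k) (Hs k))"
    define S where "S = (\<Sum>k\<in>{..<n} - {i}. potential (z ! k) (Hs k))"
    have w: "w > 0" using z i by (simp add: w_def H_def)
    have w01: "w0 \<ge> 0" "w1 \<ge> 0" "w = w0 + w1"
      using weight_nonneg weight_split[OF H, of "z ! i" p] by (simp_all add: w_def w0_def w1_def H0_def H1_def)
    have P1: "answer_prob H p (z ! i) = w1 / w"
      using answer_prob_weight[of "z ! i" H p] w by (simp add: w_def w1_def H1_def)
    have P0: "1 - answer_prob H p (z ! i) = w0 / w"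
      using answer_prob_weight_compl[of "z ! i" H p] w H by (simp add: w_def w0_def H0_def)
    have prod: "(\<Prod>k<n. weight (z ! k) ((Hs(i := K)) k)) = weight (z ! i) K * Q" for K
      unfolding Q_def using i by (subst prod.remove[of _ i]) (auto intro!: prod.cong)
    have sum: "(\<Sum>k<n. potential (z ! k) ((Hs(i := K)) k)) = potential (z ! i) K + S" for K
      unfolding S_def using i by (subst sum.remove[of _ i]) (auto intro!: sum.cong)
    have prodH: "(\<Prod>k<n. weight (z ! k) (Hs k)) = w * Q"
      and sumH: "(\<Sum>k<n. potential (z ! k) (Hs k)) = potential (z ! i) H + S"
      using prod[of H] sum[of H] by (simp_all add: H_def w_def)
    have pos: "\<forall>k<n. weight (z ! k) ((Hs(i := K)) k) > 0" if "weight (z ! i) K > 0" for K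
      using that z by simp
    have sub: "\<forall>k. (Hs(i := H0)) k \<subseteq> dom g" "\<forall>k. (Hs(i := H1)) k \<subseteq> dom g"
      using Hs H by (auto simp: H0_def H1_def split: if_splits)
    have mass0: "w0 * Q * acceptance A z b = output_mass l (Hs(i := H0)) z b" for b
    proof (cases "w0 = 0")
      case True
      have "output_mass l (Hs(i := H0)) z b = 0"
        by (rule output_mass_null[OF sub(1) i]) (use True in \<open>simp add: w0_def\<close>)
      then show ?thesis using True by simp
    next
      case False
      then show ?thesis using A pos[of H0] w01 prod[of H0] unfolding simulates_def w0_def
        by (auto simp: mult_ac)
    qed
    have mass1: "w1 * Q * acceptance B z b = output_mass r (Hs(i := H1)) z b" for b
    proof (cases "w1 = 0")
      case True
      have "output_mass r (Hs(i := H1)) z b = 0"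
        by (rule output_mass_null[OF sub(2) i]) (use True in \<open>simp add: w1_def\<close>)
      then show ?thesis using True by simp
    next
      case False
      then show ?thesis using B pos[of H1] w01 prod[of H1] unfolding simulates_def w1_def
        by (auto simp: mult_ac)
    qed
    show "acceptance R z b * (\<Prod>i<n. weight (z ! i) (Hs i)) = output_mass (Query j l r) Hs z b" for b
    proof -
      have "acceptance R z b * (w * Q) = w0 * Q * acceptance A z b + w1 * Q * acceptance B z b"
        unfolding R(2) unfolding P0 unfolding P1 using w by (simp add: field_simps)
      then show ?thesis unfolding prodH mass0 mass1
        using output_mass_query[OF Hs j, of l r z b] by (simp add: i_def p_def H_def H0_def H1_def)
    qed
    define d where "d = 42 * \<kappa> * max (dtree_depth l) (dtree_depth r)"
    have dl: "42 * \<kappa> * dtree_depth l \<le> d" "42 * \<kappa> * dtree_depth r \<le> d"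
      unfolding d_def using kappa_nonneg by (intro mult_left_mono; simp)+
    have cost0: "w0 / w * noisy_cost A z \<le> w0 / w * (potential (z ! i) H0 + S + d)"
    proof (cases "w0 = 0")
      case False
      then have "noisy_cost A z \<le> potential (z ! i) H0 + S + 42 * \<kappa> * dtree_depth l"
        using A pos[of H0] w01 sum[of H0] unfolding simulates_def w0_def by auto
      then show ?thesis using dl w w01 by (intro mult_left_mono) auto
    qed simp
    have cost1: "w1 / w * noisy_cost B z \<le> w1 / w * (potential (z ! i) H1 + S + d)"
    proof (cases "w1 = 0")
      case False
      then have "noisy_cost B z \<le> potential (z ! i) H1 + S + 42 * \<kappa> * dtree_depth r"
        using B pos[of H1] w01 sum[of H1] unfolding simulates_def w1_def by auto
      then show ?thesis using dl w w01 by (intro mult_left_mono) auto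
    qed simp
    have "noisy_cost R z \<le> answer_cost H p + w0 / w * (potential (z ! i) H0 + S + d)
        + w1 / w * (potential (z ! i) H1 + S + d)"
      unfolding R(3) unfolding P0 unfolding P1 using cost0 cost1 by simp
    also have "\<dots> = answer_cost H p + w0 / w * potential (z ! i) H0 + w1 / w * potential (z ! i) H1 + (w0 / w + w1 / w) * (S + d)"
      by (simp add: algebra_simps add_divide_distrib)
    also have "w0 / w + w1 / w = 1" using w w01 by (simp add: add_divide_distrib[symmetric])
    also have "answer_cost H p + w0 / w * potential (z ! i) H0 + w1 / w * potential (z ! i) H1 \<le> potential (z ! i) H + 42 * \<kappa>"
      using potential_step[OF H \<open>p < m\<close> _ cl, of "z ! i"] w unfolding P0 unfolding P1 by (simp add: w_def H0_def H1_def)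
    finally have "noisy_cost R z \<le> potential (z ! i) H + 42 * \<kappa> + (S + d)" by simp
    then show "noisy_cost R z \<le> (\<Sum>i<n. potential (z ! i) (Hs i)) + 42 * \<kappa> * dtree_depth (Query j l r)"
      unfolding sumH d_def by (simp add: algebra_simps max_def)
  qed
  then show ?thesis by blast
qed

text \<open>A query with parameter 1 reveals \<open>z ! i\<close> at cost 1, which is the potential
  of the block; afterwards the block is determined and has potential 0. The fiber of
  \<open>z\<close> prescribes this value already, so the output mass does not change.\<close>

lemma simulates_by_noiseless_query:
  assumes Hs: "\<forall>i. Hs i \<subseteq> dom g" and i: "i < n"
    and und: "\<not> determined (Hs i)" "\<not> undecided (Hs i)"
    and R: "\<And>c. simulates T (Hs(i := {x \<in> Hs i. g x = Some c})) (R c)"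
  shows "\<exists>R. simulates T Hs R"
proof -
  obtain Q where Q: "noisy_algorithm n Q"
    "\<And>z b. acceptance Q z b = acceptance (R (z ! i)) z b"
    "\<And>z. noisy_cost Q z = 1 + noisy_cost (R (z ! i)) z"
  proof -
    have "noisy_algorithm n (R False)" "noisy_algorithm n (R True)"
      using R unfolding simulates_def by blast+
    then obtain Q where "noisy_algorithm n Q"
      "\<And>z b. acceptance Q z b = (1 - (if z ! i then 1 else - 1)) / 2 * acceptance (R False) z b +
        (1 + (if z ! i then 1 else - 1)) / 2 * acceptance (R True) z b"
      "\<And>z. noisy_cost Q z = 1\<^sup>2 + (1 - (if z ! i then 1 else - 1)) / 2 * noisy_cost (R False) z +
        (1 + (if z ! i then 1 else - 1)) / 2 * noisy_cost (R True) z"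
      using noisy_query_exists[OF i, of 1 "R False" "R True"] by auto
    then show thesis by (intro that[of Q]) auto
  qed
  have "simulates T Hs Q"
    unfolding simulates_def
  proof (intro conjI allI impI)
    show "noisy_algorithm n Q" by (rule Q(1))
    fix z assume z: "\<forall>i<n. weight (z ! i) (Hs i) > 0"
    let ?K = "{x \<in> Hs i. g x = Some (z ! i)}"
    have wK: "weight (z ! i) ?K = weight (z ! i) (Hs i)"
      unfolding value_weight_def by (rule sum.cong) auto
    have "weight (\<not> z ! i) ?K = 0"
      unfolding value_weight_def by (rule sum.neutral) auto
    then have "determined ?K" by (cases "z ! i") (auto simp: determined_def)
    then have potK: "potential b ?K = 0" for b by (simp add: potential_def)
    have potH: "potential (z ! i) (Hs i) = 1" using und by (simp add: potential_def)
    have w: "weight (z ! k) ((Hs(i := ?K)) k) = weight (z ! k) (Hs k)" for k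
      using wK by simp
    have fib: "fiber (Hs(i := ?K)) z = fiber Hs z"
      unfolding fiber_def by (rule PiE_cong) auto
    have "(\<forall>k<n. weight (z ! k) ((Hs(i := ?K)) k) > 0) \<longrightarrow>
      (\<forall>b. acceptance (R (z ! i)) z b * (\<Prod>k<n. weight (z ! k) ((Hs(i := ?K)) k)) = output_mass T (Hs(i := ?K)) z b) \<and>
      noisy_cost (R (z ! i)) z \<le> (\<Sum>k<n. potential (z ! k) ((Hs(i := ?K)) k)) + 42 * \<kappa> * dtree_depth T"
      using R[of "z ! i"] unfolding simulates_def by (rule conjunct2[THEN spec])
    note sim = this[unfolded w, THEN mp, OF z]
    show "acceptance Q z b * (\<Prod>i<n. weight (z ! i) (Hs i)) = output_mass T Hs z b" for b
      using sim unfolding Q(2) output_mass_def fib by simp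
    have "(\<Sum>k<n. potential (z ! k) (Hs k)) = 1 + (\<Sum>k\<in>{..<n} - {i}. potential (z ! k) (Hs k))"
      using i potH by (subst sum.remove[of _ i]) auto
    moreover have "(\<Sum>k<n. potential (z ! k) ((Hs(i := ?K)) k)) = (\<Sum>k\<in>{..<n} - {i}. potential (z ! k) (Hs k))"
      using i potK by (subst sum.remove[of _ i]) (auto intro!: sum.cong)
    ultimately show "noisy_cost Q z \<le> (\<Sum>i<n. potential (z ! i) (Hs i)) + 42 * \<kappa> * dtree_depth T"
      using sim unfolding Q(3) by simp
  qed
  then show ?thesis by blast
qed

lemma simulation_exists:
  assumes "\<forall>i. Hs i \<subseteq> dom g" "dtree_on (n * m) T"
  shows "\<exists>R. simulates T Hs R"
  using assms
proof (induction T arbitrary: Hs)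
  case (Leaf b)
  have "simulates (Leaf b) Hs (return_pmf (NLeaf b))"
    unfolding simulates_def
  proof (intro conjI allI impI)
    fix z c
    have "output_mass (Leaf b) Hs z c = (\<Sum>x\<in>fiber Hs z. \<Prod>i<n. \<mu> (x i)) * of_bool (b = c)"
      by (simp add: output_mass_def)
    then show "acceptance (return_pmf (NLeaf b)) z c * (\<Prod>i<n. weight (z ! i) (Hs i)) = output_mass (Leaf b) Hs z c"
      using sum_fiber[of Hs z] Leaf by (simp add: noisy_run_def bind_return_pmf)
    show "noisy_cost (return_pmf (NLeaf b)) z \<le> (\<Sum>i<n. potential (z ! i) (Hs i)) + 42 * \<kappa> * dtree_depth (Leaf b)"
      using Leaf by (simp add: noisy_cost_def noisy_run_def bind_return_pmf sum_nonneg potential_nonneg)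
  qed (simp add: noisy_algorithm_def)
  then show ?case by blast
next
  case (Query j l r)
  define i where "i = j div m"
  have j: "j < n * m" using Query.prems by simp
  have i: "i < n" using j by (simp add: i_def less_mult_imp_div_less)
  \<comment> \<open>Stated for arbitrary \<open>Ks\<close>, as it is applied to \<open>Hs\<close>
    itself and to \<open>Hs\<close> with block \<open>i\<close> restricted to a revealed
    value.\<close>
  have step: "\<exists>R. simulates (Query j l r) Ks R"
    if K: "\<forall>k. Ks k \<subseteq> dom g" and c: "determined (Ks i) \<or> undecided (Ks i)" for Ks
  proof -
    have sub: "\<forall>k. (Ks(j div m := {x \<in> Ks (j div m). P x})) k \<subseteq> dom g" for P
      using K by (auto split: if_splits)
    have on: "dtree_on (n * m) l" "dtree_on (n * m) r" using Query.prems(2) by auto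
    obtain A where "simulates l (Ks(j div m := {x \<in> Ks (j div m). \<not> x ! (j mod m)})) A"
      using Query.IH(1)[OF sub[of "\<lambda>x. \<not> x ! (j mod m)"] on(1)] by blast
    moreover obtain B where "simulates r (Ks(j div m := {x \<in> Ks (j div m). x ! (j mod m)})) B"
      using Query.IH(2)[OF sub[of "\<lambda>x. x ! (j mod m)"] on(2)] by blast
    ultimately show ?thesis using c unfolding i_def by (intro simulates_query[OF K j])
  qed
  show ?case
  proof (cases "determined (Hs i) \<or> undecided (Hs i)")
    case True
    then show ?thesis using step Query.prems by blast
  next
    case False
    have "\<exists>R. simulates (Query j l r) (Hs(i := {x \<in> Hs i. g x = Some c})) R" for c
    proof (rule step)
      show "\<forall>k. (Hs(i := {x \<in> Hs i. g x = Some c})) k \<subseteq> dom g"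
        using Query.prems(1) by auto
      have "weight (\<not> c) {x \<in> Hs i. g x = Some c} = 0"
        unfolding value_weight_def by (rule sum.neutral) auto
      then show "determined ((Hs(i := {x \<in> Hs i. g x = Some c})) i) \<or> undecided ((Hs(i := {x \<in> Hs i. g x = Some c})) i)"
        by (cases c) (auto simp: determined_def)
    qed
    then obtain R where "\<And>c. simulates (Query j l r) (Hs(i := {x \<in> Hs i. g x = Some c})) (R c)" by metis
    then show ?thesis using simulates_by_noiseless_query[OF Query.prems(1) i] False by blast
  qed
qed

end

section \<open>The composition theorem\<close>

text \<open>Initially every block has even odds, hence bias 0 and, by
  \<open>\<Phi> (dom g) \<le> 0\<close>, a nonpositive potential, so only the charge per query
  remains. Each block contributes a weight of 1/2, whence \<open>2 ^ n\<close>.\<close>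

lemma (in block_simulation) balanced_simulation_exists:
  assumes "\<Phi> (dom g) \<le> 0" "\<And>b. weight b (dom g) = 1 / 2" "dtree_on (n * m) T"
  shows "\<exists>R. noisy_algorithm n R \<and>
    (\<forall>z b. acceptance R z b = 2 ^ n * output_mass T (\<lambda>_. dom g) z b) \<and>
    (\<forall>z. noisy_cost R z \<le> 42 * \<kappa> * dtree_depth T)"
proof -
  obtain R where R: "simulates T (\<lambda>_. dom g) R"
    using simulation_exists[of "\<lambda>_. dom g" T] assms(3) by blast
  have pot: "potential b (dom g) \<le> 0" for b
    using assms(1) by (simp add: assms(2) potential_def determined_def undecided_def bias_def bias_value_def)
  have "acceptance R z b = 2 ^ n * output_mass T (\<lambda>_. dom g) z b" for z b
  proof -
    have "acceptance R z b * (\<Prod>i<n. 1 / 2) = output_mass T (\<lambda>_. dom g) z b"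
      using R by (simp add: simulates_def assms(2))
    then show ?thesis by (auto simp: power_divide field_simps)
  qed
  moreover have "noisy_cost R z \<le> 42 * \<kappa> * dtree_depth T" for z
  proof -
    have "noisy_cost R z \<le> (\<Sum>i<n. potential (z ! i) (dom g)) + 42 * \<kappa> * dtree_depth T"
      using R by (simp add: simulates_def assms(2))
    moreover have "(\<Sum>i<n. potential (z ! i) (dom g)) \<le> 0" using pot by (intro sum_nonpos) auto
    ultimately show ?thesis by linarith
  qed
  ultimately show ?thesis using R unfolding simulates_def by blast
qed

section \<open>Existence of optimal decision tree algorithms\<close>

lemma finite_bounded_dtrees: "finite {T. dtree_on N T \<and> dtree_depth T \<le> d}"
proof (induction d)
  case 0
  have "{T. dtree_on N T \<and> dtree_depth T \<le> 0} \<subseteq> range Leaf"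
  proof
    fix T assume "T \<in> {T. dtree_on N T \<and> dtree_depth T \<le> 0}"
    then show "T \<in> range Leaf" by (cases T) auto
  qed
  then show ?case by (rule finite_subset) simp
next
  case (Suc d)
  let ?S = "{T. dtree_on N T \<and> dtree_depth T \<le> d}"
  have "{T. dtree_on N T \<and> dtree_depth T \<le> Suc d} \<subseteq>
    range Leaf \<union> (\<lambda>(i, l, r). Query i l r) ` ({..<N} \<times> ?S \<times> ?S)"
  proof
    fix T assume "T \<in> {T. dtree_on N T \<and> dtree_depth T \<le> Suc d}"
    then show "T \<in> range Leaf \<union> (\<lambda>(i, l, r). Query i l r) ` ({..<N} \<times> ?S \<times> ?S)"
      by (cases T) (force simp: image_iff)+
  qed
  then show ?case by (rule finite_subset) (use Suc in simp)
qed

text \<open>Ensures that the minimum defining the randomized query complexity is attained. The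
  induction is on the length \<open>k\<close> of the prefix that is looked at, so the tree reads the
  bits from the last to the first.\<close>

lemma dtree_computing_exists:
  "\<exists>T. dtree_on N T \<and> (\<forall>x. length x = N \<longrightarrow> dtree_output T x = h x)"
proof -
  have "\<exists>T. dtree_on N T \<and> (\<forall>x. length x = N \<longrightarrow> dtree_output T x = h (take k x))"
    if "k \<le> N" for k h
    using that
  proof (induction k arbitrary: h)
    case 0
    show ?case by (rule exI[of _ "Leaf (h [])"]) simp
  next
    case (Suc k)
    obtain l where l: "dtree_on N l" "\<And>x. length x = N \<Longrightarrow> dtree_output l x = h (take k x @ [False])"
      using Suc.IH[of "\<lambda>y. h (y @ [False])"] Suc.prems by auto
    obtain r where r: "dtree_on N r" "\<And>x. length x = N \<Longrightarrow> dtree_output r x = h (take k x @ [True])"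
      using Suc.IH[of "\<lambda>y. h (y @ [True])"] Suc.prems by auto
    have "dtree_output (Query k l r) x = h (take (Suc k) x)" if "length x = N" for x
      using that Suc.prems l r by (cases "x ! k") (simp_all add: take_Suc_conv_app_nth)
    then show ?case using l r Suc.prems by (intro exI[of _ "Query k l r"]) auto
  qed
  from this[of N h] show ?thesis by auto
qed

lemma randomized_query_complexity_attained:
  assumes "partial_boolean_function N f"
  obtains P where "\<And>T. T \<in> set_pmf P \<Longrightarrow> dtree_on N T \<and> dtree_depth T \<le> randomized_query_complexity N f"
    "randomized_computes (1/3) P f"
proof -
  obtain T where T: "dtree_on N T" "\<And>x. length x = N \<Longrightarrow> dtree_output T x = the (f x)"
    using dtree_computing_exists[of N "\<lambda>x. the (f x)"] by blast
  have "randomized_computes (1/3) (return_pmf T) f"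
    using T(2) assms by (auto simp: randomized_computes_def partial_boolean_function_def)
  then have "\<exists>P. (\<forall>T' \<in> set_pmf P. dtree_on N T' \<and> dtree_depth T' \<le> dtree_depth T) \<and> randomized_computes (1/3) P f"
    using T(1) by (intro exI[of _ "return_pmf T"]) auto
  from LeastI[of "\<lambda>d. \<exists>P. (\<forall>T \<in> set_pmf P. dtree_on N T \<and> dtree_depth T \<le> d) \<and> randomized_computes (1/3) P f", OF this]
  show thesis using that unfolding randomized_query_complexity_def[symmetric] by blast
qed

lemma block_concat:
  assumes "\<And>i. i < n \<Longrightarrow> length (x i) = m" "i < n"
  shows "block m (concat (map x [0..<n])) i = x i"
proof (rule nth_equalityI)
  have "(i + 1) * m \<le> n * m" using assms(2) by (intro mult_right_mono) auto
  then have le: "i * m + m \<le> n * m" by simp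
  have len: "length (concat (map x [0..<n])) = n * m" using assms(1) by (rule length_concat_blocks)
  show len_block: "length (block m (concat (map x [0..<n])) i) = length (x i)"
    using le len assms by (simp add: block_def)
  fix k assume "k < length (block m (concat (map x [0..<n])) i)"
  then have k: "k < m" using len_block assms by simp
  then have "block m (concat (map x [0..<n])) i ! k = concat (map x [0..<n]) ! (i * m + k)"
    using le assms(2) nth_drop[of "i * m" "concat (map x [0..<n])" k] unfolding len by (simp add: block_def)
  also have "\<dots> = x ((i * m + k) div m) ! ((i * m + k) mod m)"
    using le k assms(1) by (intro nth_concat_blocks) auto
  also have "\<dots> = x i ! k" using k by simp
  finally show "block m (concat (map x [0..<n])) i ! k = x i ! k" .
qed

lemma noisy_query_complexity_le:
  assumes "finite (dom f)" "noisy_algorithm n R" "noisy_computes (1/3) R f"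
    "B \<ge> 0" "\<And>z. z \<in> dom f \<Longrightarrow> noisy_cost R z \<le> B"
  shows "noisy_query_complexity n f \<le> B"
proof -
  have "noisy_max_cost R f \<ge> 0" for R
    using assms(1) by (simp add: noisy_max_cost_def)
  then have "bdd_below ((\<lambda>R. noisy_max_cost R f) ` S)" for S
    by (intro bdd_belowI[of _ 0]) auto
  then have "noisy_query_complexity n f \<le> noisy_max_cost R f"
    unfolding noisy_query_complexity_def noisy_query_complexity_err_def
    using assms by (intro cINF_lower) auto
  also have "\<dots> \<le> B" using assms by (auto simp: noisy_max_cost_def)
  finally show ?thesis .
qed

lemma partial_boolean_function_block_compose: "partial_boolean_function (n * m) (block_compose n m f g)"
  by (auto simp: partial_boolean_function_def block_compose_def split: if_splits)

text \<open>Each tree of an optimal algorithm for the composition is simulated separately, and the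
  simulations are mixed in the same proportions.\<close>

lemma noisy_query_complexity_composition:
  assumes f: "partial_boolean_function n f" and g: "partial_boolean_function m g"
    and r: "randomized_query_complexity m g > 0"
  shows "noisy_query_complexity n f \<le>
    42 * (156 / randomized_query_complexity m g) * randomized_query_complexity (n * m) (block_compose n m f g)"
proof -
  define \<kappa> where "\<kappa> = 156 / real (randomized_query_complexity m g)"
  define d where "d = randomized_query_complexity (n * m) (block_compose n m f g)"
  have \<kappa>: "\<kappa> > 0" using r by (simp add: \<kappa>_def)
  have fin: "finite (dom g)" by (rule finite_dom_partial_boolean_function[OF g])
  obtain \<mu> where \<mu>: "\<And>x. \<mu> x \<ge> 0" "(\<Sum>x\<in>dom g. \<mu> x) = 1"
    "\<And>D. ltree_on m D \<Longrightarrow> (\<Sum>x\<in>dom g. \<mu> x * payoff \<kappa> g D x) \<le> 0"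
    using hard_distribution_exists[OF fin r] unfolding \<kappa>_def by blast
  have half: "value_weight g \<mu> b (dom g) = 1 / 2" for b
    using \<mu> by (intro balanced_if_leaf_payoffs_nonpos[OF fin, of _ \<kappa>]) auto
  obtain \<Phi> where \<Phi>: "\<Phi> (dom g) \<le> 0"
    "\<And>H. H \<subseteq> dom g \<Longrightarrow> bias_value (value_weight g \<mu> True H) (value_weight g \<mu> False H) \<le> \<Phi> H"
    "\<And>H p. H \<subseteq> dom g \<Longrightarrow> p < m \<Longrightarrow> \<Phi> {x \<in> H. \<not> x ! p} + \<Phi> {x \<in> H. x ! p} \<le>
       \<Phi> H + \<kappa> * (value_weight g \<mu> True H + value_weight g \<mu> False H)"
    using optimal_payoff_exists[OF fin \<mu>(1) \<kappa> \<mu>(3)] by blast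
  interpret block_simulation n m g \<mu> \<kappa> \<Phi>
    using g \<mu>(1) \<kappa> \<Phi> by unfold_locales auto
  obtain P where P: "\<And>T. T \<in> set_pmf P \<Longrightarrow> dtree_on (n * m) T \<and> dtree_depth T \<le> d"
    and comp: "randomized_computes (1/3) P (block_compose n m f g)"
    using randomized_query_complexity_attained[OF partial_boolean_function_block_compose]
    unfolding d_def by blast
  \<comment> \<open>Noisy algorithms must have finite support; bounded depth on finitely many bits
    provides it.\<close>
  have finP: "finite (set_pmf P)"
    by (rule finite_subset[OF _ finite_bounded_dtrees[of "n * m" d]]) (use P in auto)
  have "\<forall>T. \<exists>R. dtree_on (n * m) T \<longrightarrow> noisy_algorithm n R \<and>
    (\<forall>z b. acceptance R z b = 2 ^ n * output_mass T (\<lambda>_. dom g) z b) \<and>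
    (\<forall>z. noisy_cost R z \<le> 42 * \<kappa> * dtree_depth T)"
    using balanced_simulation_exists[OF \<Phi>(1) half] by blast
  then obtain F where F: "\<And>T. dtree_on (n * m) T \<Longrightarrow> noisy_algorithm n (F T)"
    "\<And>T z b. dtree_on (n * m) T \<Longrightarrow> acceptance (F T) z b = 2 ^ n * output_mass T (\<lambda>_. dom g) z b"
    "\<And>T z. dtree_on (n * m) T \<Longrightarrow> noisy_cost (F T) z \<le> 42 * \<kappa> * dtree_depth T"
    by metis
  define R where "R = bind_pmf P F"
  have finF: "finite (set_pmf (F T))" if "T \<in> set_pmf P" for T
    using that P F(1) by (auto simp: noisy_algorithm_def)
  have R: "noisy_algorithm n R"
    using finP P F(1) by (fastforce simp: R_def noisy_algorithm_def)
  have finR: "finite (set_pmf R)" using R by (simp add: noisy_algorithm_def)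
  have cost: "noisy_cost R z \<le> 42 * \<kappa> * d" for z
  proof -
    have "noisy_cost R z = measure_pmf.expectation P (\<lambda>T. noisy_cost (F T) z)"
    proof -
      have "noisy_cost R z = measure_pmf.expectation P (\<lambda>T. measure_pmf.expectation (F T) (\<lambda>N.
          measure_pmf.expectation (noisy_tree_run N z) snd))"
        unfolding noisy_cost_eq_expectation[OF finR] unfolding R_def
        by (rule expectation_bind_finite[OF finP finF])
      also have "\<dots> = measure_pmf.expectation P (\<lambda>T. noisy_cost (F T) z)"
        using finF by (intro integral_cong_AE) (auto simp: AE_measure_pmf_iff noisy_cost_eq_expectation)
      finally show ?thesis .
    qed
    also have "\<dots> \<le> measure_pmf.expectation P (\<lambda>_. 42 * \<kappa> * d)"
    proof (rule expectation_mono_finite[OF finP])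
      fix T assume T: "T \<in> set_pmf P"
      have "noisy_cost (F T) z \<le> 42 * \<kappa> * dtree_depth T" using F(3) P[OF T] by blast
      also have "\<dots> \<le> 42 * \<kappa> * d" using P[OF T] \<kappa> by (intro mult_left_mono) auto
      finally show "noisy_cost (F T) z \<le> 42 * \<kappa> * d" .
    qed
    finally show ?thesis by simp
  qed
  have "noisy_computes (1/3) R f"
    unfolding noisy_computes_def
  proof
    fix z assume z: "z \<in> dom f"
    define b where "b = the (f z)"
    have len: "length z = n" using z f by (auto simp: partial_boolean_function_def)
    let ?S = "fiber (\<lambda>_. dom g) z"
    let ?c = "\<lambda>x. concat (map x [0..<n])"
    \<comment> \<open>Every tuple in the fiber of \<open>z\<close> is an input of the composition
      with value \<open>f z\<close>, so the original algorithm is right on it with probability at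
      least 2/3.\<close>
    have good: "measure_pmf.expectation P (\<lambda>T. of_bool (dtree_output T (?c x) = b)) \<ge> (2 / 3 :: real)" if x: "x \<in> ?S" for x
    proof -
      have lenx: "length (x i) = m" if "i < n" for i
        using fiber_length[OF _ x that] by blast
      have gx: "g (x i) = Some (z ! i)" if "i < n" for i
        using PiE_mem[OF x[unfolded fiber_def], of i] that by simp
      have "map (\<lambda>i. the (g (block m (?c x) i))) [0..<n] = z"
        using len by (intro nth_equalityI) (auto simp: block_concat lenx gx)
      moreover have "\<forall>i<n. block m (?c x) i \<in> dom g"
        using gx by (auto simp: block_concat lenx)
      moreover have "length (?c x) = n * m" using lenx by (rule length_concat_blocks)
      ultimately have eq: "block_compose n m f g (?c x) = f z" by (simp add: block_compose_def)
      then have "?c x \<in> dom (block_compose n m f g)" using z by auto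
      from comp[unfolded randomized_computes_def pmf_map_eq_expectation, rule_format, OF this]
      show ?thesis unfolding eq b_def by simp
    qed
    have "acceptance R z b = measure_pmf.expectation P (\<lambda>T. acceptance (F T) z b)"
    proof -
      have "acceptance R z b = measure_pmf.expectation P (\<lambda>T. measure_pmf.expectation (F T) (\<lambda>N.
          measure_pmf.expectation (noisy_tree_run N z) (\<lambda>t. of_bool (fst t = b))))"
        unfolding acceptance_eq_expectation[OF finR] unfolding R_def
        by (rule expectation_bind_finite[OF finP finF])
      also have "\<dots> = measure_pmf.expectation P (\<lambda>T. acceptance (F T) z b)"
        using finF by (intro integral_cong_AE) (auto simp: AE_measure_pmf_iff acceptance_eq_expectation)
      finally show ?thesis .
    qed
    also have "\<dots> = measure_pmf.expectation P (\<lambda>T. 2 ^ n * output_mass T (\<lambda>_. dom g) z b)"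
      using P F(2) by (intro integral_cong_AE) (auto simp: AE_measure_pmf_iff)
    also have "\<dots> = 2 ^ n * (\<Sum>x\<in>?S. (\<Prod>i<n. \<mu> (x i)) * measure_pmf.expectation P (\<lambda>T. of_bool (dtree_output T (?c x) = b)))"
      unfolding output_mass_def using finP
      by (simp add: Bochner_Integration.integral_sum integrable_measure_pmf_finite)
    \<comment> \<open>The simulation succeeds with the average of these probabilities over the
      fiber, whose total mass \<open>(1/2) ^ n\<close> is normalised by
      \<open>2 ^ n\<close>.\<close>
    also have "\<dots> \<ge> 2 ^ n * (\<Sum>x\<in>?S. (\<Prod>i<n. \<mu> (x i)) * (2 / 3))"
      using good \<mu>(1) by (intro mult_left_mono sum_mono prod_nonneg) auto
    also have "2 ^ n * (\<Sum>x\<in>?S. (\<Prod>i<n. \<mu> (x i)) * (2 / 3)) = 2 / 3"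
      unfolding sum_distrib_right[symmetric] using sum_fiber[of "\<lambda>_. dom g" z]
      by (simp add: half power_divide)
    finally show "1 - 1 / 3 \<le> pmf (map_pmf fst (noisy_run R z)) (the (f z))"
      by (simp add: b_def)
  qed
  then show ?thesis
    using noisy_query_complexity_le[OF finite_dom_partial_boolean_function[OF f] R, of "42 * \<kappa> * d"] cost \<kappa>
    unfolding \<kappa>_def d_def by simp
qed

theorem theorem1p4:
  "\<exists>c::real. c > 0 \<and>
     (\<forall>(n::nat) (m::nat) (f :: bool list \<rightharpoonup> bool) (g :: bool list \<rightharpoonup> bool).
        partial_boolean_function n f \<longrightarrow> partial_boolean_function m g \<longrightarrow>
        real (randomized_query_complexity (n * m) (block_compose n m f g))
          \<ge> c * noisy_query_complexity n f * real (randomized_query_complexity m g))"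
proof (intro exI[of _ "1 / 6552"] conjI allI impI)
  fix n m and f g :: "bool list \<rightharpoonup> bool"
  assume "partial_boolean_function n f" "partial_boolean_function m g"
  \<comment> \<open>The constant is \<open>6552 = 42 * 156\<close>. If the complexity of
    \<open>g\<close> is 0, the right-hand side vanishes.\<close>
  then show "real (randomized_query_complexity (n * m) (block_compose n m f g))
          \<ge> 1 / 6552 * noisy_query_complexity n f * real (randomized_query_complexity m g)"
    using noisy_query_complexity_composition[of n f m g]
    by (cases "randomized_query_complexity m g = 0") (auto simp: field_simps)
qed simp

end
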